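(* Let $\delta_0\in[1,\infty)$. Let $A$ be the first order, nodal, symmetric interior penalty discontinuous Galerkin (SIPG) discretization matrix with penalty parameter $\delta_0$ of the 1D Laplacian with periodic boundary conditions, and consider the two-level iteration with one presmoothing step using the cell block-Jacobi smoother $D=D_c$ with relaxation parameter $\alpha\in\mathbb{R}$, whose error iteration operator is $$E_\alpha=(I-PA_0^{-1}RA)(I-\alpha D_c^{-1}A)$$ (all operators as defined in the context). Then the optimal relaxation parameter, i.e. the value of $\alpha$ that maximizes the error reduction of the two-level iteration by minimizing over $\alpha\in\mathbb{R}$ the spectral radius $\rho(\alpha)$ defined in the context, is $$\alpha_{\mathrm{opt}}=\begin{cases}\dfrac{\delta_0(2\delta_0-1)}{2\delta_0^2-1}, & 1\le\delta_0\le\widetilde\delta_+,\\[2mm] \dfrac{2\delta_0^2(2\delta_0-1)}{\delta_0\left|2\delta_0^2-4\delta_0+1\right|+2\delta_0^3+4\delta_0^2-5\delta_0+1}, & \widetilde\delta_+\le\delta_0\le\widetilde\delta_-,\\[2mm] \dfrac{2\delta_0^2}{2\delta_0^2+\delta_0-1}, & \widetilde\delta_-\le\delta_0,\end{cases}$$ where $\widetilde\delta_+=\frac1{12}\left(8+\sqrt[3]{152-24\sqrt{33}}+2\sqrt[3]{19+3\sqrt{33}}\right)=1.41964\dots$ and $\widetilde\delta_-=\frac32$.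
   Context: Mesh and unknowns. Let $J$ be an even positive integer and $h=1/J$. A discontinuous piecewise linear function on a uniform mesh with cells of length $h$ is described by its nodal values $v_j^+$ and $v_j^-$, the values at the left and right endpoint of cell $j$, respectively. The periodic problem is treated by local Fourier analysis, so grid functions $v=(v_j^+,v_j^-)_{j\in\mathbb{Z}}$ with complex values on the infinite uniform mesh are considered, and the operators below act on them. Operator $A$ (SIPG for $-u''$, polynomial degree $1$, penalty $\delta=\delta_0/h$): $$(Av)_j^+=\tfrac1{h^2}\left(-\tfrac12 v_{j-1}^+ +(1-\delta_0)v_{j-1}^- +\delta_0 v_j^+ -\tfrac12 v_{j+1}^+\right),$$ $$(Av)_j^-=\tfrac1{h^2}\left(-\tfrac12 v_{j-1}^- +\delta_0 v_j^- +(1-\delta_0)v_{j+1}^+ -\tfrac12 v_{j+1}^-\right).$$ Cell block-Jacobi smoother $D_c$ (the $2\times2$ diagonal blocks of $A$ belonging to the two unknowns $v_j^+,v_j^-$ of each cell; for the Laplacian these are diagonal): $(D_cv)_j^\pm=\tfrac{\delta_0}{h^2}v_j^\pm$. Restriction $R$ to the coarse mesh whose cell $m$ is the union of fine cells $2m-1$ and $2m$: $$(Rv)_m^+=\tfrac12\left(v_{2m-1}^++\tfrac12v_{2m-1}^-+\tfrac12v_{2m}^+\right),\qquad (Rv)_m^-=\tfrac12\left(\tfrac12v_{2m-1}^-+\tfrac12v_{2m}^++v_{2m}^-\right).$$ Prolongation $P=2R^{\top}$ (linear interpolation), coarse operator $A_0=RAP$. Two-level iteration: $u^{(i+1)}=u^{(i)}+M^{-1}(f-Au^{(i)})$,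 where $M^{-1}g=y$ is computed by $x=\alpha D^{-1}g$, $y=x+PA_0^{-1}R(g-Ax)$. Its error iteration operator is $E_\alpha=I-M^{-1}A=(I-PA_0^{-1}RA)(I-\alpha D^{-1}A)$. Fourier blocks and spectral radius. For real $k\in[-J/2,J/2]$ let $F_k$ be the $4$-dimensional space of fine grid functions of the form $v_j^\pm=(a^\pm+(-1)^jb^\pm)e^{2\pi i kjh}$ with $a^\pm,b^\pm\in\mathbb{C}$ (frequencies $k$ and $k-J/2$), and $G_k$ the $2$-dimensional space of coarse grid functions $V_m^\pm=a^\pm e^{2\pi i k\,2mh}$. Then $A$ and $D$ map $F_k$ to itself, $R$ maps $F_k$ to $G_k$, $P$ maps $G_k$ to $F_k$, and $A_0$ maps $G_k$ to itself; $D$ is invertible on $F_k$, and $A_0$ is invertible on $G_k$ for $k\notin\{0,\pm J/2\}$. Let $\widehat E_\alpha(k)$ be the restriction of $E_\alpha$ to $F_k$, a $4\times4$ matrix after choosing a basis. Define $$\rho(\alpha)=\sup\{\text{spectral radius of }\widehat E_\alpha(k): k\in[-J/2,J/2],\ k\notin\{0,\pm J/2\}\}.$$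
   Formalization: Uniqueness of the minimizing α is asserted only for δ₀ > 1; at δ₀ = 1 one has ρ(α) = max(1, |1−2α|), so every α in [0,1] is a minimizer, and α_opt = 1 is stated only as one of them. *)

theory Defs
  imports Complex_Main "HOL-Library.Extended_Real" "Jordan_Normal_Form.Spectral_Radius"
begin

text \<open>
  A cell carries two nodal values: \<open>Plus\<close> is the value at its left endpoint (written with a
  superscript plus), \<open>Minus\<close> the value at its right endpoint.
\<close>

datatype node = Plus | Minus

type_synonym grid = "int \<Rightarrow> node \<Rightarrow> complex"

definition mesh_size :: "nat \<Rightarrow> real" where
  "mesh_size J = 1 / real J"

fun sipg :: "nat \<Rightarrow> real \<Rightarrow> grid \<Rightarrow> grid" where
  "sipg J \<delta> v j Plus =
     of_real (1 / (mesh_size J)\<^sup>2) *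
       (- (1/2) * v (j - 1) Plus + of_real (1 - \<delta>) * v (j - 1) Minus
        + of_real \<delta> * v j Plus - (1/2) * v (j + 1) Plus)"
| "sipg J \<delta> v j Minus =
     of_real (1 / (mesh_size J)\<^sup>2) *
       (- (1/2) * v (j - 1) Minus + of_real \<delta> * v j Minus
        + of_real (1 - \<delta>) * v (j + 1) Plus - (1/2) * v (j + 1) Minus)"

definition cell_jacobi :: "nat \<Rightarrow> real \<Rightarrow> grid \<Rightarrow> grid" where
  "cell_jacobi J \<delta> v j s = of_real (\<delta> / (mesh_size J)\<^sup>2) * v j s"

text \<open>Coarse cell \<open>m\<close> is the union of the fine cells \<open>2 * m - 1\<close> and \<open>2 * m\<close>.\<close>

fun restriction :: "grid \<Rightarrow> grid" where
  "restriction v m Plus =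
     (1/2) * (v (2 * m - 1) Plus + (1/2) * v (2 * m - 1) Minus + (1/2) * v (2 * m) Plus)"
| "restriction v m Minus =
     (1/2) * ((1/2) * v (2 * m - 1) Minus + (1/2) * v (2 * m) Plus + v (2 * m) Minus)"

text \<open>
  The prolongation is twice the transpose of the restriction, written out row by row; the lemma
  \<open>prolongation_transpose\<close> below compares the matrix entries. The coarse cell that contains the
  fine cell \<open>j\<close> has index \<open>(j + 1) div 2\<close>.
\<close>

fun prolongation :: "grid \<Rightarrow> grid" where
  "prolongation V j Plus =
     (let m = (j + 1) div 2 in
      if odd j then V m Plus else (1/2) * (V m Plus + V m Minus))"
| "prolongation V j Minus =
     (let m = (j + 1) div 2 in
      if odd j then (1/2) * (V m Plus + V m Minus) else V m Minus)"

definition unit_grid :: "int \<Rightarrow> node \<Rightarrow> grid" where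
  "unit_grid i r = (\<lambda>j s. if j = i \<and> s = r then 1 else 0)"

lemma prolongation_transpose:
  "prolongation (unit_grid m r) j s = 2 * restriction (unit_grid j s) m r"
proof (cases "odd j")
  case True
  then obtain i where "j = 2 * i + 1" by (elim oddE)
  then show ?thesis
    by (cases r; cases s; auto simp: unit_grid_def; presburger)
next
  case False
  then obtain i where "j = 2 * i" by blast
  then show ?thesis
    by (cases r; cases s; auto simp: unit_grid_def; presburger)
qed

definition coarse_op :: "nat \<Rightarrow> real \<Rightarrow> grid \<Rightarrow> grid" where
  "coarse_op J \<delta> V = restriction (sipg J \<delta> (prolongation V))"

text \<open>
  The coordinates \<open>c\<close> of a fine grid function for the frequencies \<open>k\<close> and \<open>k - J/2\<close> are, in this
  order, a for \<open>Plus\<close>, a for \<open>Minus\<close>, b for \<open>Plus\<close>, b for \<open>Minus\<close>.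
\<close>

fun fine_mode :: "nat \<Rightarrow> real \<Rightarrow> complex vec \<Rightarrow> grid" where
  "fine_mode J k c j Plus =
     (c $ 0 + (- 1) powi j * c $ 2) * cis (2 * pi * k * of_int j * mesh_size J)"
| "fine_mode J k c j Minus =
     (c $ 1 + (- 1) powi j * c $ 3) * cis (2 * pi * k * of_int j * mesh_size J)"

fun coarse_mode :: "nat \<Rightarrow> real \<Rightarrow> complex vec \<Rightarrow> grid" where
  "coarse_mode J k c m Plus = c $ 0 * cis (2 * pi * k * (2 * of_int m) * mesh_size J)"
| "coarse_mode J k c m Minus = c $ 1 * cis (2 * pi * k * (2 * of_int m) * mesh_size J)"

definition fine_space :: "nat \<Rightarrow> real \<Rightarrow> grid set" where
  "fine_space J k = fine_mode J k ` carrier_vec 4"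

definition coarse_space :: "nat \<Rightarrow> real \<Rightarrow> grid set" where
  "coarse_space J k = coarse_mode J k ` carrier_vec 2"

lemma inj_on_fine_mode: "inj_on (fine_mode J k) (carrier_vec 4)"
proof (rule inj_onI)
  fix c d :: "complex vec"
  assume c: "c \<in> carrier_vec 4" and d: "d \<in> carrier_vec 4"
    and eq: "fine_mode J k c = fine_mode J k d"
  have e: "fine_mode J k c j s = fine_mode J k d j s" for j s
    by (simp add: eq)
  have "c $ 0 + c $ 2 = d $ 0 + d $ 2" "c $ 0 - c $ 2 = d $ 0 - d $ 2"
    using e[of 0 Plus] e[of 1 Plus] by auto
  moreover have "c $ 1 + c $ 3 = d $ 1 + d $ 3" "c $ 1 - c $ 3 = d $ 1 - d $ 3"
    using e[of 0 Minus] e[of 1 Minus] by auto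
  ultimately have *: "c $ 0 = d $ 0" "c $ 1 = d $ 1" "c $ 2 = d $ 2" "c $ 3 = d $ 3"
    by (smt (verit) add_diff_cancel_left' add_diff_eq diff_add_cancel mult_2 mult_cancel_left
        zero_neq_numeral)+
  show "c = d"
  proof (rule eq_vecI)
    fix i assume "i < dim_vec d"
    with d have "i = 0 \<or> i = 1 \<or> i = 2 \<or> i = 3" by auto
    with * show "c $ i = d $ i" by auto
  qed (use c d in auto)
qed

text \<open>
  The inverses of the smoother and of the coarse operator are the inverses of their restrictions
  to the Fourier spaces for the frequency \<open>k\<close>.
\<close>

definition smoothing_op :: "nat \<Rightarrow> real \<Rightarrow> real \<Rightarrow> real \<Rightarrow> grid \<Rightarrow> grid" where
  "smoothing_op J \<delta> k \<alpha> v =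
     v - (\<lambda>j s. of_real \<alpha> * inv_into (fine_space J k) (cell_jacobi J \<delta>) (sipg J \<delta> v) j s)"

definition coarse_correction :: "nat \<Rightarrow> real \<Rightarrow> real \<Rightarrow> grid \<Rightarrow> grid" where
  "coarse_correction J \<delta> k v =
     v - prolongation
           (inv_into (coarse_space J k) (coarse_op J \<delta>) (restriction (sipg J \<delta> v)))"

definition error_op :: "nat \<Rightarrow> real \<Rightarrow> real \<Rightarrow> real \<Rightarrow> grid \<Rightarrow> grid" where
  "error_op J \<delta> k \<alpha> v = coarse_correction J \<delta> k (smoothing_op J \<delta> k \<alpha> v)"

text \<open>The matrix of the error operator on the fine Fourier space; column \<open>q\<close> holds the coordinates
  of the image of basis vector \<open>q\<close>.\<close>

definition error_matrix :: "nat \<Rightarrow> real \<Rightarrow> real \<Rightarrow> real \<Rightarrow> complex mat" where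
  "error_matrix J \<delta> k \<alpha> =
     mat 4 4 (\<lambda>(p, q).
       inv_into (carrier_vec 4) (fine_mode J k)
         (error_op J \<delta> k \<alpha> (fine_mode J k (unit_vec 4 q))) $ p)"

definition frequencies :: "nat \<Rightarrow> real set" where
  "frequencies J = {- real J / 2 .. real J / 2} - {0, real J / 2, - real J / 2}"

text \<open>The supremum is taken in the extended reals, where it exists unconditionally.\<close>

definition rho :: "nat \<Rightarrow> real \<Rightarrow> real \<Rightarrow> ereal" where
  "rho J \<delta> \<alpha> = (SUP k \<in> frequencies J. ereal (spectral_radius (error_matrix J \<delta> k \<alpha>)))"

definition delta_plus :: real where
  "delta_plus =
     (1/12) * (8 + root 3 (152 - 24 * sqrt 33) + 2 * root 3 (19 + 3 * sqrt 33))"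

definition delta_minus :: real where
  "delta_minus = 3 / 2"

end

theory Submission
  imports Defs
begin

text \<open>
  Nonzero eigenvalues of the error operator have their eigenvectors in \<open>ker (R A)\<close>. There the
  operator is \<open>I - \<omega> C A\<close> with the coarse correction \<open>C\<close>, an \<open>A\<close>-orthogonal projection along
  the range of \<open>P\<close>, and \<open>\<omega> = \<alpha> / \<delta>\<close>. Hence these eigenvalues are \<open>1 - \<omega> \<mu>\<close>, where the numbers
  \<open>1 / \<mu>\<close> are the eigenvalues of the compression of the inverse of \<open>A\<close> to \<open>ker R\<close>, a
  two-by-two matrix. With \<open>g = 2 * \<delta> - 1\<close> and \<open>x\<close> the square of the cosine of the angle
  \<open>2 * pi * k / J\<close>, the rates \<open>\<mu>\<close> are the roots of
  \<open>(1 - x) (\<mu> - g) ((g + 1) \<mu> - 2 g) + x (\<mu> - 2) (g \<mu> - (g\<^sup>2 - 1))\<close>.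
  Since this is a convex combination of two quadratics, all \<open>\<mu>\<close> lie between the extreme roots of
  the two, and these are attained or approached. The optimal \<open>\<omega>\<close> is \<open>2 / (m + M)\<close> for the
  extreme rates \<open>m\<close> and \<open>M\<close>; the thresholds in \<open>\<delta>\<close> are where the extreme roots change roles.
\<close>

section \<open>Fourier symbols\<close>

text \<open>The factor by which a Fourier mode of frequency \<open>k\<close> changes from one cell
  to the next. The symbols depend on \<open>J\<close> and \<open>k\<close> only through this
  unimodular number, called \<open>e\<close> below.\<close>

definition phase :: "nat \<Rightarrow> real \<Rightarrow> complex" where
  "phase J k = cis (2 * pi * k * mesh_size J)"

lemma phase_mult_cnj [simp]: "phase J k * cnj (phase J k) = 1"
  by (simp add: phase_def cis_cnj cis_mult)

text \<open>The operator \<open>A\<close> without its factor 1/h^2, in the coordinates of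
  \<open>fine_mode\<close>. The second block is the first one at \<open>- e\<close>, since a factor
  (-1)^j reverses the sign of every shift by one cell.\<close>

definition sipg_symbol :: "real \<Rightarrow> complex \<Rightarrow> complex mat" where
  "sipg_symbol \<delta> e = mat_of_rows_list 4
     [[of_real (\<delta> - Re e), of_real (1 - \<delta>) * cnj e, 0, 0],
      [of_real (1 - \<delta>) * e, of_real (\<delta> - Re e), 0, 0],
      [0, 0, of_real (\<delta> + Re e), - of_real (1 - \<delta>) * cnj e],
      [0, 0, - of_real (1 - \<delta>) * e, of_real (\<delta> + Re e)]]"

text \<open>Waves are normalised at the fine cell \<open>2 * m\<close>. The cell
  \<open>2 * m - 1\<close> contributes the terms with \<open>cnj e\<close>, with the opposite sign
  in the last two columns, where the alternating factor is -1.\<close>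

definition restriction_symbol :: "complex \<Rightarrow> complex mat" where
  "restriction_symbol e = mat_of_rows_list 4
     [[cnj e / 2 + 1/4, cnj e / 4, 1/4 - cnj e / 2, - cnj e / 4],
      [1/4, cnj e / 4 + 1/2, 1/4, 1/2 - cnj e / 4]]"

text \<open>The conjugate transpose of \<open>restriction_symbol\<close>. The factor 2 in the
  definition of prolongation is absorbed by the two fine cells in each coarse cell.\<close>

definition prolongation_symbol :: "complex \<Rightarrow> complex mat" where
  "prolongation_symbol e = mat_of_rows_list 2
     [[e / 2 + 1/4, 1/4], [e / 4, e / 4 + 1/2], [1/4 - e / 2, 1/4], [- e / 4, 1/2 - e / 4]]"

text \<open>Determinant of twice the symbol of the Galerkin product in
  \<open>coarse_symbol_mult\<close>; the phases of its off-diagonal entries cancel.\<close>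

definition coarse_det :: "real \<Rightarrow> complex \<Rightarrow> real" where
  "coarse_det \<delta> e = (\<delta> - Re (e\<^sup>2) / 2)\<^sup>2 - (\<delta> - 1/2)\<^sup>2"

definition coarse_inverse_symbol :: "real \<Rightarrow> complex \<Rightarrow> complex mat" where
  "coarse_inverse_symbol \<delta> e = mat_of_rows_list 2
     [[of_real (2 * (\<delta> - Re (e\<^sup>2) / 2) / coarse_det \<delta> e),
       of_real (2 * (\<delta> - 1/2) / coarse_det \<delta> e) * cnj (e\<^sup>2)],
      [of_real (2 * (\<delta> - 1/2) / coarse_det \<delta> e) * e\<^sup>2,
       of_real (2 * (\<delta> - Re (e\<^sup>2) / 2) / coarse_det \<delta> e)]]"

lemma symbol_carrier [simp]:
  "sipg_symbol \<delta> e \<in> carrier_mat 4 4"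
  "restriction_symbol e \<in> carrier_mat 2 4"
  "prolongation_symbol e \<in> carrier_mat 4 2"
  "coarse_inverse_symbol \<delta> e \<in> carrier_mat 2 2"
  by (rule carrier_matI; simp add: sipg_symbol_def restriction_symbol_def prolongation_symbol_def
      coarse_inverse_symbol_def mat_of_rows_list_def)+

lemma vec4_eqI:
  assumes "v \<in> carrier_vec 4" "w \<in> carrier_vec 4"
    and "v $ 0 = w $ 0" "v $ 1 = w $ 1" "v $ 2 = w $ 2" "v $ 3 = w $ 3"
  shows "v = w"
proof (rule eq_vecI)
  fix i assume "i < dim_vec w"
  with assms(2) have "i = 0 \<or> i = 1 \<or> i = 2 \<or> i = 3" by auto
  with assms show "v $ i = w $ i" by auto
qed (use assms in auto)

lemma vec2_eqI:
  assumes "v \<in> carrier_vec 2" "w \<in> carrier_vec 2" and "v $ 0 = w $ 0" "v $ 1 = w $ 1"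
  shows "v = w"
proof (rule eq_vecI)
  fix i assume "i < dim_vec w"
  with assms(2) have "i = 0 \<or> i = 1" by auto
  with assms show "v $ i = w $ i" by auto
qed (use assms in auto)

lemma sum_upto_4: "(\<Sum>i\<in>{0..<4::nat}. f i) = f 0 + f 1 + f 2 + (f 3 :: 'a :: comm_monoid_add)"
  by (simp add: eval_nat_numeral add.assoc)

lemma sum_upto_2: "(\<Sum>i\<in>{0..<2::nat}. f i) = f 0 + (f 1 :: 'a :: comm_monoid_add)"
  by (simp add: eval_nat_numeral)

text \<open>The index one appears as \<open>Suc 0\<close>, the form to which the simplifier rewrites
  it.\<close>

lemma sipg_symbol_mult:
  assumes "c \<in> carrier_vec 4"
  shows "(sipg_symbol \<delta> e *\<^sub>v c) $ 0 = of_real (\<delta> - Re e) * c $ 0 + of_real (1 - \<delta>) * cnj e * c $ 1"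
    and "(sipg_symbol \<delta> e *\<^sub>v c) $ Suc 0 = of_real (1 - \<delta>) * e * c $ 0 + of_real (\<delta> - Re e) * c $ 1"
    and "(sipg_symbol \<delta> e *\<^sub>v c) $ 2 = of_real (\<delta> + Re e) * c $ 2 - of_real (1 - \<delta>) * cnj e * c $ 3"
    and "(sipg_symbol \<delta> e *\<^sub>v c) $ 3 = of_real (\<delta> + Re e) * c $ 3 - of_real (1 - \<delta>) * e * c $ 2"
  using assms
  by (simp_all add: sipg_symbol_def mat_of_rows_list_def scalar_prod_def sum_upto_4 algebra_simps)

lemma restriction_symbol_mult:
  assumes "c \<in> carrier_vec 4"
  shows "(restriction_symbol e *\<^sub>v c) $ 0 =
      (cnj e / 2 + 1/4) * c $ 0 + cnj e / 4 * c $ 1 + (1/4 - cnj e / 2) * c $ 2 - cnj e / 4 * c $ 3"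
    and "(restriction_symbol e *\<^sub>v c) $ Suc 0 =
      1/4 * c $ 0 + (cnj e / 4 + 1/2) * c $ 1 + 1/4 * c $ 2 + (1/2 - cnj e / 4) * c $ 3"
  using assms
  by (simp_all add: restriction_symbol_def mat_of_rows_list_def scalar_prod_def sum_upto_4)

lemma prolongation_symbol_mult:
  assumes "z \<in> carrier_vec 2"
  shows "(prolongation_symbol e *\<^sub>v z) $ 0 = (e / 2 + 1/4) * z $ 0 + 1/4 * z $ 1"
    and "(prolongation_symbol e *\<^sub>v z) $ Suc 0 = e / 4 * z $ 0 + (e / 4 + 1/2) * z $ 1"
    and "(prolongation_symbol e *\<^sub>v z) $ 2 = (1/4 - e / 2) * z $ 0 + 1/4 * z $ 1"
    and "(prolongation_symbol e *\<^sub>v z) $ 3 = - e / 4 * z $ 0 + (1/2 - e / 4) * z $ 1"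
  using assms
  by (simp_all add: prolongation_symbol_def mat_of_rows_list_def scalar_prod_def sum_upto_2)

lemma coarse_inverse_symbol_mult:
  assumes "z \<in> carrier_vec 2"
  shows "(coarse_inverse_symbol \<delta> e *\<^sub>v z) $ 0 =
      of_real (2 * (\<delta> - Re (e\<^sup>2) / 2) / coarse_det \<delta> e) * z $ 0 +
      of_real (2 * (\<delta> - 1/2) / coarse_det \<delta> e) * cnj (e\<^sup>2) * z $ 1"
    and "(coarse_inverse_symbol \<delta> e *\<^sub>v z) $ Suc 0 =
      of_real (2 * (\<delta> - 1/2) / coarse_det \<delta> e) * e\<^sup>2 * z $ 0 +
      of_real (2 * (\<delta> - Re (e\<^sup>2) / 2) / coarse_det \<delta> e) * z $ 1"
  using assms
  by (simp_all add: coarse_inverse_symbol_def mat_of_rows_list_def scalar_prod_def sum_upto_2)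

section \<open>Action of the grid operators on Fourier modes\<close>

definition wave :: "nat \<Rightarrow> real \<Rightarrow> int \<Rightarrow> complex" where
  "wave J k j = cis (2 * pi * k * of_int j * mesh_size J)"

lemma wave_shift:
  "wave J k (j - 1) = cnj (phase J k) * wave J k j"
  "wave J k (j + 1) = phase J k * wave J k j"
  by (simp_all add: wave_def phase_def cis_cnj cis_mult algebra_simps)

lemma fine_mode_wave:
  "fine_mode J k c j Plus = (c $ 0 + (-1) powi j * c $ 2) * wave J k j"
  "fine_mode J k c j Minus = (c $ 1 + (-1) powi j * c $ 3) * wave J k j"
  by (simp_all add: wave_def)

lemma coarse_mode_wave:
  "coarse_mode J k z m Plus = z $ 0 * wave J k (2 * m)"
  "coarse_mode J k z m Minus = z $ 1 * wave J k (2 * m)"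
  by (simp_all add: wave_def)

lemma minus_one_powi_shift:
  "(-1 :: complex) powi (j - 1) = - ((-1) powi j)" "(-1 :: complex) powi (j + 1) = - ((-1) powi j)"
  by (simp_all add: power_int_diff power_int_add)

lemma two_Re: "of_real (Re e) = (e + cnj e) / 2"
  by (simp add: complex_add_cnj)

declare fine_mode.simps [simp del] coarse_mode.simps [simp del]

text \<open>A shift by one cell multiplies the non-alternating part of a mode by the phase or its
  conjugate, and the alternating part by the negative of that. The stencil thus turns into the
  entries of the symbol.\<close>

lemma sipg_fine_mode:
  assumes "c \<in> carrier_vec 4"
  shows "sipg J \<delta> (fine_mode J k c) j s =
    of_real (1 / (mesh_size J)\<^sup>2) * fine_mode J k (sipg_symbol \<delta> (phase J k) *\<^sub>v c) j s"
proof -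
  define e where "e = phase J k"
  define d where "d = complex_of_real \<delta>"
  show ?thesis
    by (cases s; simp only: sipg.simps; rule arg_cong[where f = "(*) _"])
      (simp_all add: sipg_symbol_mult[OF assms] fine_mode_wave wave_shift minus_one_powi_shift two_Re
          flip: e_def d_def,
       simp_all add: algebra_simps add_divide_distrib diff_divide_distrib)
qed

lemma restriction_fine_mode:
  assumes "c \<in> carrier_vec 4"
  shows "restriction (fine_mode J k c) m s = coarse_mode J k (restriction_symbol (phase J k) *\<^sub>v c) m s"
proof (cases s)
  case Plus
  show ?thesis unfolding Plus
    by (simp add: restriction_symbol_mult[OF assms] fine_mode_wave coarse_mode_wave wave_shift
        minus_one_powi_shift algebra_simps)
next
  case Minus
  show ?thesis unfolding Minus
    by (simp add: restriction_symbol_mult[OF assms] fine_mode_wave coarse_mode_wave wave_shift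
        minus_one_powi_shift algebra_simps)
qed

lemma prolongation_coarse_mode:
  assumes "z \<in> carrier_vec 2"
  shows "prolongation (coarse_mode J k z) j s =
    fine_mode J k (prolongation_symbol (phase J k) *\<^sub>v z) j s"
proof -
  define m where "m = (j + 1) div 2"
  define e where "e = phase J k"
  \<comment> \<open>In the odd cell \<open>2 * m - 1\<close> the wave carries a factor
    \<open>cnj e\<close>, which has to cancel the factor \<open>e\<close> of the symbol. These rules
    do so inside products.\<close>
  have e1: "e * cnj e = 1"
    by (simp add: e_def)
  have ee: "e * (cnj e * x) = x" for x
    using e1 by (simp flip: mult.assoc)
  have ea: "e * (a * (cnj e * x)) = a * x" for a x
    by (simp only: mult.left_commute[of e a] ee)
  have ee': "cnj e * (e * x) = x" for x
    by (simp only: mult.left_commute[of "cnj e" e] ee)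
  show ?thesis
  proof (cases "odd j")
    case True
    then have j: "j = 2 * m - 1" unfolding m_def by presburger
    have "prolongation V j Plus = V m Plus"
      "prolongation V j Minus = (1/2) * (V m Plus + V m Minus)" for V
      using True by (simp_all add: Let_def m_def)
    note pr = this[unfolded j]
    show ?thesis unfolding j
      by (cases s)
        (simp_all del: prolongation.simps add: pr prolongation_symbol_mult[OF assms] fine_mode_wave coarse_mode_wave
          wave_shift minus_one_powi_shift flip: e_def, simp_all add: ring_distribs ee ee' ea e1 mult.assoc)
  next
    case False
    then have j: "j = 2 * m" unfolding m_def by presburger
    have "prolongation V j Plus = (1/2) * (V m Plus + V m Minus)"
      "prolongation V j Minus = V m Minus" for V
      using False by (simp_all add: Let_def m_def)
    note pr = this[unfolded j]
    show ?thesis unfolding j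
      by (cases s)
        (simp_all del: prolongation.simps add: pr prolongation_symbol_mult[OF assms] fine_mode_wave coarse_mode_wave
          flip: e_def, simp_all add: ring_distribs)
  qed
qed

section \<open>The error operator on the Fourier spaces\<close>

lemma inj_on_coarse_mode: "inj_on (coarse_mode J k) (carrier_vec 2)"
proof (rule inj_onI)
  fix z w assume z: "z \<in> carrier_vec 2" and w: "w \<in> carrier_vec 2"
    and eq: "coarse_mode J k z = coarse_mode J k w"
  have "coarse_mode J k z 0 s = coarse_mode J k w 0 s" for s
    by (simp add: eq)
  from this[of Plus] this[of Minus] show "z = w"
    by (intro vec2_eqI[OF z w]) (simp_all add: coarse_mode_wave wave_def)
qed

lemma fine_mode_smult:
  assumes "c \<in> carrier_vec 4"
  shows "fine_mode J k (a \<cdot>\<^sub>v c) j s = a * fine_mode J k c j s"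
  using assms by (cases s) (simp_all add: fine_mode_wave algebra_simps)

lemma fine_mode_minus:
  assumes "c \<in> carrier_vec 4" "d \<in> carrier_vec 4"
  shows "fine_mode J k (c - d) j s = fine_mode J k c j s - fine_mode J k d j s"
  using assms by (cases s) (simp_all add: fine_mode_wave algebra_simps)

lemma coarse_mode_smult:
  assumes "z \<in> carrier_vec 2"
  shows "coarse_mode J k (a \<cdot>\<^sub>v z) j s = a * coarse_mode J k z j s"
  using assms by (cases s) (simp_all add: coarse_mode_wave algebra_simps)

lemma symbol_mult_carrier [simp]:
  "sipg_symbol \<delta> e *\<^sub>v c \<in> carrier_vec 4"
  "restriction_symbol e *\<^sub>v c \<in> carrier_vec 2"
  "prolongation_symbol e *\<^sub>v z \<in> carrier_vec 4"
  "coarse_inverse_symbol \<delta> e *\<^sub>v z \<in> carrier_vec 2"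
  by (rule carrier_vecI, simp only: dim_mult_mat_vec carrier_matD[OF symbol_carrier(1)]
    carrier_matD[OF symbol_carrier(2)] carrier_matD[OF symbol_carrier(3)] carrier_matD[OF symbol_carrier(4)])+

text \<open>The entries of restriction times \<open>A\<close> times prolongation, cleared of denominators, with
  \<open>f\<close> the inverse of \<open>e\<close> and \<open>c\<close> its real part.\<close>

lemma coarse_symbol_identity:
  fixes e f c d x y :: complex
  assumes ef: "e * f = 1" and c: "e + f = 2 * c"
  defines "a \<equiv> (2 * e + 1) * x + y" and "b \<equiv> e * x + (e + 2) * y"
    and "a' \<equiv> (1 - 2 * e) * x + y" and "b' \<equiv> (2 - e) * y - e * x"
  shows "(2 * f + 1) * ((d - c) * a + (1 - d) * f * b) + f * ((1 - d) * e * a + (d - c) * b) +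
      (1 - 2 * f) * ((d + c) * a' - (1 - d) * f * b') - f * ((d + c) * b' - (1 - d) * e * a') =
      4 * ((2 * d - 2 * c\<^sup>2 + 1) * x + (1 - 2 * d) * f\<^sup>2 * y)" (is ?first)
    and "((d - c) * a + (1 - d) * f * b) + (f + 2) * ((1 - d) * e * a + (d - c) * b) +
      ((d + c) * a' - (1 - d) * f * b') + (2 - f) * ((d + c) * b' - (1 - d) * e * a') =
      4 * ((1 - 2 * d) * e\<^sup>2 * x + (2 * d - 2 * c\<^sup>2 + 1) * y)" (is ?second)
proof -
  \<comment> \<open>Normal form: \<open>e\<close> is eliminated, then the quadratic equation of
    \<open>f\<close> lowers every power of \<open>f\<close> to at most one.\<close>
  have e: "e = 2 * c - f"
    using c by (simp add: algebra_simps)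
  have ff: "f * f = 2 * c * f - 1"
    using ef unfolding e by (simp add: algebra_simps)
  have fft: "f * (f * t) = 2 * (c * (f * t)) - t" for t
  proof -
    have "f * (f * t) = (f * f) * t"
      by (rule mult.assoc[symmetric])
    also have "\<dots> = 2 * (c * (f * t)) - t"
      unfolding ff by (simp add: algebra_simps)
    finally show ?thesis .
  qed
  show ?first ?second
    unfolding a_def b_def a'_def b'_def e
    by (simp_all add: algebra_simps power2_eq_square ff fft)
qed

section \<open>The Galerkin coarse operator and its inverse\<close>

text \<open>The coarse operator is again of SIPG type: its symbol is a quarter of the first block of
  \<open>sipg_symbol\<close> at \<open>2 * \<delta>\<close> and \<open>e\<^sup>2\<close>, as for
  mesh size 2h and the unchanged penalty \<delta>/h.\<close>

lemma coarse_symbol_mult: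
  fixes \<delta> :: real and e :: complex and z :: "complex vec"
  assumes z: "z \<in> carrier_vec 2" and e: "e * cnj e = 1"
  defines "w \<equiv> restriction_symbol e *\<^sub>v (sipg_symbol \<delta> e *\<^sub>v (prolongation_symbol e *\<^sub>v z))"
  shows "w $ 0 = of_real ((\<delta> - Re (e\<^sup>2) / 2) / 2) * z $ 0 + of_real ((1/2 - \<delta>) / 2) * cnj (e\<^sup>2) * z $ 1"
    and "w $ Suc 0 = of_real ((1/2 - \<delta>) / 2) * e\<^sup>2 * z $ 0 + of_real ((\<delta> - Re (e\<^sup>2) / 2) / 2) * z $ 1"
proof -
  define f where "f = cnj e"
  define c d x y where "c = complex_of_real (Re e)" and "d = complex_of_real \<delta>" and "x = z $ 0" and "y = z $ 1"
  have ef: "e * f = 1" using e by (simp add: f_def)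
  have c: "e + f = 2 * c"
    by (simp add: f_def c_def complex_add_cnj)
  have r: "of_real (Re (e\<^sup>2)) = (e\<^sup>2 + f\<^sup>2) / 2"
    using two_Re[of "e\<^sup>2"] by (simp_all add: f_def)
  define A where "A = sipg_symbol \<delta> e *\<^sub>v (prolongation_symbol e *\<^sub>v z)"
  \<comment> \<open>The factors 4 here and in the entries of \<open>A\<close> below clear the
    quarters in the symbols of restriction and prolongation, so that
    \<open>coarse_symbol_identity\<close> applies.\<close>
  have w': "4 * w $ 0 = (2 * f + 1) * A $ 0 + f * A $ 1 + (1 - 2 * f) * A $ 2 - f * A $ 3"
    "4 * w $ 1 = A $ 0 + (f + 2) * A $ 1 + A $ 2 + (2 - f) * A $ 3"
    by (simp_all add: w_def A_def restriction_symbol_mult field_simps f_def)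
  have A: "4 * A $ 0 = (d - c) * ((2 * e + 1) * x + y) + (1 - d) * f * (e * x + (e + 2) * y)"
    "4 * A $ 1 = (1 - d) * e * ((2 * e + 1) * x + y) + (d - c) * (e * x + (e + 2) * y)"
    "4 * A $ 2 = (d + c) * ((1 - 2 * e) * x + y) - (1 - d) * f * ((2 - e) * y - e * x)"
    "4 * A $ 3 = (d + c) * ((2 - e) * y - e * x) - (1 - d) * e * ((1 - 2 * e) * x + y)"
    by (simp_all add: A_def sipg_symbol_mult prolongation_symbol_mult z f_def c_def d_def x_def y_def)
      (simp_all add: field_simps)
  have "4 * (4 * w $ 0) = (2 * f + 1) * (4 * A $ 0) + f * (4 * A $ 1) + (1 - 2 * f) * (4 * A $ 2) - f * (4 * A $ 3)"
    "4 * (4 * w $ 1) = 4 * A $ 0 + (f + 2) * (4 * A $ 1) + 4 * A $ 2 + (2 - f) * (4 * A $ 3)"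
    unfolding w' by (simp_all add: algebra_simps)
  then have "4 * (4 * w $ 0) = 4 * ((2 * d - 2 * c\<^sup>2 + 1) * x + (1 - 2 * d) * f\<^sup>2 * y)"
    "4 * (4 * w $ 1) = 4 * ((1 - 2 * d) * e\<^sup>2 * x + (2 * d - 2 * c\<^sup>2 + 1) * y)"
    unfolding A coarse_symbol_identity[OF ef c] .
  then have w: "w $ 0 = ((2 * d - 2 * c\<^sup>2 + 1) * x + (1 - 2 * d) * f\<^sup>2 * y) / 4"
    "w $ 1 = ((1 - 2 * d) * e\<^sup>2 * x + (2 * d - 2 * c\<^sup>2 + 1) * y) / 4"
    by (simp_all only: mult_cancel_left eq_divide_eq_numeral1 mult.commute[of _ 4]) simp_all
  have r: "complex_of_real (Re (e\<^sup>2)) = 2 * c\<^sup>2 - 1"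
  proof -
    have "(2 * c)\<^sup>2 = e\<^sup>2 + f\<^sup>2 + 2 * (e * f)"
      unfolding c[symmetric] by (simp add: power2_eq_square algebra_simps)
    then show ?thesis
      unfolding r ef by (simp add: power_mult_distrib field_simps)
  qed
  show "w $ 0 = of_real ((\<delta> - Re (e\<^sup>2) / 2) / 2) * z $ 0 + of_real ((1/2 - \<delta>) / 2) * cnj (e\<^sup>2) * z $ 1"
    unfolding w(1)[unfolded One_nat_def]
    by (simp add: r x_def y_def d_def f_def algebra_simps add_divide_distrib diff_divide_distrib)
  show "w $ Suc 0 = of_real ((1/2 - \<delta>) / 2) * e\<^sup>2 * z $ 0 + of_real ((\<delta> - Re (e\<^sup>2) / 2) / 2) * z $ 1"
    unfolding w(2)[unfolded One_nat_def]
    by (simp add: r x_def y_def d_def f_def algebra_simps add_divide_distrib diff_divide_distrib)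
qed

text \<open>The adjugate formula for a two-by-two matrix, with off-diagonal phases that cancel by
  \<open>E * F = 1\<close>. Later the right inverse supplies preimages under the coarse operator,
  and the left inverse its injectivity.\<close>

lemma coarse_symbol_inverse:
  fixes \<delta> :: real and e :: complex and z :: "complex vec"
  assumes z: "z \<in> carrier_vec 2" and e: "e * cnj e = 1" and det: "coarse_det \<delta> e \<noteq> 0"
  shows "restriction_symbol e *\<^sub>v (sipg_symbol \<delta> e *\<^sub>v (prolongation_symbol e *\<^sub>v
           (coarse_inverse_symbol \<delta> e *\<^sub>v z))) = z" (is ?right)
    and "coarse_inverse_symbol \<delta> e *\<^sub>v (restriction_symbol e *\<^sub>v (sipg_symbol \<delta> e *\<^sub>v
           (prolongation_symbol e *\<^sub>v z))) = z" (is ?left)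
proof -
  define a b E F D where "a = complex_of_real (\<delta> - Re (e\<^sup>2) / 2)" and "b = complex_of_real (\<delta> - 1/2)"
    and "E = e\<^sup>2" and "F = cnj (e\<^sup>2)" and "D = complex_of_real (coarse_det \<delta> e)"
  have EF: "E * F = 1"
    using e by (simp add: E_def F_def flip: power_mult_distrib)
  have D: "D \<noteq> 0" "D = a\<^sup>2 - b\<^sup>2"
    using det by (simp add: D_def, simp add: D_def coarse_det_def a_def b_def)
  have of_real:
    "complex_of_real ((\<delta> - Re (e\<^sup>2) / 2) / 2) = a / 2"
    "complex_of_real ((1 / 2 - \<delta>) / 2) = - b / 2"
    "complex_of_real (2 * (\<delta> - Re (e\<^sup>2) / 2) / coarse_det \<delta> e) = 2 * a / D"
    "complex_of_real (2 * (\<delta> - 1/2) / coarse_det \<delta> e) = 2 * b / D"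
    by (simp_all add: a_def b_def D_def field_simps)
  let ?B = "\<lambda>v. restriction_symbol e *\<^sub>v (sipg_symbol \<delta> e *\<^sub>v (prolongation_symbol e *\<^sub>v v))"
  let ?Z = "\<lambda>v. coarse_inverse_symbol \<delta> e *\<^sub>v v"
  have B: "?B v $ 0 = a / 2 * v $ 0 - b / 2 * F * v $ 1" "?B v $ 1 = a / 2 * v $ 1 - b / 2 * E * v $ 0"
    and Z: "?Z v $ 0 = 2 * a / D * v $ 0 + 2 * b / D * F * v $ 1"
      "?Z v $ 1 = 2 * a / D * v $ 1 + 2 * b / D * E * v $ 0"
    if "v \<in> carrier_vec 2" for v
    using coarse_symbol_mult[OF that e, of \<delta>] coarse_inverse_symbol_mult[OF that, of \<delta> e]
    by (simp_all only: of_real E_def F_def One_nat_def) simp_all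
  \<comment> \<open>Both components of each product are instances of this: exchanging the phases
    \<open>G\<close> and \<open>H\<close> exchanges the components.\<close>
  have cancel: "a / 2 * (2 * a / D * x + 2 * b / D * G * y) - b / 2 * G * (2 * a / D * y + 2 * b / D * H * x) = x"
    "2 * a / D * (a / 2 * x - b / 2 * G * y) + 2 * b / D * G * (a / 2 * y - b / 2 * H * x) = x"
    if "H * G = 1" for x y G H
  proof -
    have "(a * (a * x + b * G * y) - b * G * (b * H * x + a * y)) / D = x"
      "(a * (a * x - b * G * y) + b * G * (a * y - b * H * x)) / D = x"
    proof -
      have "b * G * (b * H * x) = b\<^sup>2 * (H * G) * x"
        by (simp add: power2_eq_square)
      also have "\<dots> = b\<^sup>2 * x"
        using that by simp
      finally have 1: "b * G * (b * H * x) = b\<^sup>2 * x" .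
      have "a * (a * x + b * G * y) - b * G * (b * H * x + a * y) = a\<^sup>2 * x - b * G * (b * H * x)"
        "a * (a * x - b * G * y) + b * G * (a * y - b * H * x) = a\<^sup>2 * x - b * G * (b * H * x)"
        by (simp_all add: algebra_simps power2_eq_square)
      then have "a * (a * x + b * G * y) - b * G * (b * H * x + a * y) = x * D"
        "a * (a * x - b * G * y) + b * G * (a * y - b * H * x) = x * D"
        by (simp_all only: 1) (simp_all add: D(2) algebra_simps)
      then show "(a * (a * x + b * G * y) - b * G * (b * H * x + a * y)) / D = x"
        "(a * (a * x - b * G * y) + b * G * (a * y - b * H * x)) / D = x"
        using D(1) by simp_all
    qed
    then show "a / 2 * (2 * a / D * x + 2 * b / D * G * y) - b / 2 * G * (2 * a / D * y + 2 * b / D * H * x) = x"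
      "2 * a / D * (a / 2 * x - b / 2 * G * y) + 2 * b / D * G * (a / 2 * y - b / 2 * H * x) = x"
      by (simp_all add: algebra_simps add_divide_distrib diff_divide_distrib)
  qed
  have FE: "F * E = 1"
    using EF by (simp add: mult.commute)
  show ?right
  proof (rule vec2_eqI)
    show "?B (?Z z) $ 0 = z $ 0" "?B (?Z z) $ 1 = z $ 1"
      using cancel(1)[OF EF, of "z $ 0" "z $ 1"] cancel(1)[OF FE, of "z $ 1" "z $ 0"]
      by (simp_all only: B Z z symbol_mult_carrier)
  qed (use z in simp_all)
  show ?left
  proof (rule vec2_eqI)
    show "?Z (?B z) $ 0 = z $ 0" "?Z (?B z) $ 1 = z $ 1"
      using cancel(2)[OF EF, of "z $ 0" "z $ 1"] cancel(2)[OF FE, of "z $ 1" "z $ 0"]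
      by (simp_all only: B Z z symbol_mult_carrier)
  qed (use z in simp_all)
qed

section \<open>From symbols back to grid functions\<close>

lemma mesh_size_pos: "J > 0 \<Longrightarrow> mesh_size J > 0"
  by (simp add: mesh_size_def)

lemma restriction_scale: "restriction (\<lambda>j s. a * v j s) m s = a * restriction v m s"
  by (cases s) (simp_all add: algebra_simps)

lemma coarse_op_coarse_mode:
  assumes "z \<in> carrier_vec 2"
  shows "coarse_op J \<delta> (coarse_mode J k z) =
    coarse_mode J k (of_real (1 / (mesh_size J)\<^sup>2) \<cdot>\<^sub>v
      (restriction_symbol (phase J k) *\<^sub>v (sipg_symbol \<delta> (phase J k) *\<^sub>v
        (prolongation_symbol (phase J k) *\<^sub>v z))))"
proof (intro ext)
  fix m s
  have P: "prolongation (coarse_mode J k z) = fine_mode J k (prolongation_symbol (phase J k) *\<^sub>v z)"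
    by (intro ext prolongation_coarse_mode assms)
  have A: "sipg J \<delta> (fine_mode J k c) =
      (\<lambda>j s. of_real (1 / (mesh_size J)\<^sup>2) * fine_mode J k (sipg_symbol \<delta> (phase J k) *\<^sub>v c) j s)"
    if "c \<in> carrier_vec 4" for c
    by (intro ext sipg_fine_mode that)
  show "coarse_op J \<delta> (coarse_mode J k z) m s =
    coarse_mode J k (of_real (1 / (mesh_size J)\<^sup>2) \<cdot>\<^sub>v
      (restriction_symbol (phase J k) *\<^sub>v (sipg_symbol \<delta> (phase J k) *\<^sub>v
        (prolongation_symbol (phase J k) *\<^sub>v z)))) m s"
    unfolding coarse_op_def P
    by (subst A, simp, subst restriction_scale, subst restriction_fine_mode, simp,
        subst coarse_mode_smult, simp_all)
qed

lemma restriction_sipg_fine_mode: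
  assumes "c \<in> carrier_vec 4"
  shows "restriction (sipg J \<delta> (fine_mode J k c)) =
    coarse_mode J k (of_real (1 / (mesh_size J)\<^sup>2) \<cdot>\<^sub>v
      (restriction_symbol (phase J k) *\<^sub>v (sipg_symbol \<delta> (phase J k) *\<^sub>v c)))"
proof (intro ext)
  fix m s
  have A: "sipg J \<delta> (fine_mode J k c) =
      (\<lambda>j s. of_real (1 / (mesh_size J)\<^sup>2) * fine_mode J k (sipg_symbol \<delta> (phase J k) *\<^sub>v c) j s)"
    by (intro ext sipg_fine_mode assms)
  show "restriction (sipg J \<delta> (fine_mode J k c)) m s =
    coarse_mode J k (of_real (1 / (mesh_size J)\<^sup>2) \<cdot>\<^sub>v
      (restriction_symbol (phase J k) *\<^sub>v (sipg_symbol \<delta> (phase J k) *\<^sub>v c))) m s"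
    by (subst A, subst restriction_scale, subst restriction_fine_mode, simp,
        subst coarse_mode_smult, simp_all)
qed

text \<open>\<open>inv_into\<close> merely chooses some preimage. It agrees with the inverse symbol
  once the coarse operator is injective on the coarse space and an explicit preimage in that space
  is known. The factor 1/h^2 cancels.\<close>

lemma coarse_correction_fine_mode:
  assumes J: "J > 0" and d: "d \<in> carrier_vec 4" and det: "coarse_det \<delta> (phase J k) \<noteq> 0"
  defines "e \<equiv> phase J k"
  shows "coarse_correction J \<delta> k (fine_mode J k d) =
    fine_mode J k (d - prolongation_symbol e *\<^sub>v (coarse_inverse_symbol \<delta> e *\<^sub>v
      (restriction_symbol e *\<^sub>v (sipg_symbol \<delta> e *\<^sub>v d))))"
proof -
  define C where "C = complex_of_real (1 / (mesh_size J)\<^sup>2)"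
  have C: "C \<noteq> 0"
    using mesh_size_pos[OF J] by (simp add: C_def)
  have ee: "e * cnj e = 1"
    by (simp add: e_def)
  define r where "r = restriction_symbol e *\<^sub>v (sipg_symbol \<delta> e *\<^sub>v d)"
  define z where "z = coarse_inverse_symbol \<delta> e *\<^sub>v r"
  have z: "z \<in> carrier_vec 2" and r: "r \<in> carrier_vec 2"
    by (simp_all add: z_def r_def)
  have "inj_on (coarse_op J \<delta>) (coarse_space J k)"
  proof (rule inj_onI)
    fix V W assume "V \<in> coarse_space J k" "W \<in> coarse_space J k"
      and eq: "coarse_op J \<delta> V = coarse_op J \<delta> W"
    then obtain v w where v: "v \<in> carrier_vec 2" "V = coarse_mode J k v"
      and w: "w \<in> carrier_vec 2" "W = coarse_mode J k w"
      by (auto simp: coarse_space_def)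
    let ?B = "\<lambda>v. restriction_symbol e *\<^sub>v (sipg_symbol \<delta> e *\<^sub>v (prolongation_symbol e *\<^sub>v v))"
    have "C \<cdot>\<^sub>v ?B v = C \<cdot>\<^sub>v ?B w"
      using eq inj_onD[OF inj_on_coarse_mode, of J k "C \<cdot>\<^sub>v ?B v" "C \<cdot>\<^sub>v ?B w"]
      by (simp add: v w coarse_op_coarse_mode C_def e_def)
    then have "(1 / C) \<cdot>\<^sub>v (C \<cdot>\<^sub>v ?B v) = (1 / C) \<cdot>\<^sub>v (C \<cdot>\<^sub>v ?B w)"
      by simp
    then have "?B v = ?B w"
      using C by (simp add: smult_smult_assoc)
    then have "v = w"
      by (metis coarse_symbol_inverse(2) v(1) w(1) det ee e_def)
    then show "V = W"
      by (simp add: v w)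
  qed
  moreover have "coarse_op J \<delta> (coarse_mode J k z) = restriction (sipg J \<delta> (fine_mode J k d))"
    using coarse_symbol_inverse(1)[OF r ee, of \<delta>] det
    unfolding coarse_op_coarse_mode[OF z] restriction_sipg_fine_mode[OF d] e_def[symmetric]
    by (simp add: z_def r_def)
  moreover have "coarse_mode J k z \<in> coarse_space J k"
    using z by (simp add: coarse_space_def)
  ultimately have inv: "inv_into (coarse_space J k) (coarse_op J \<delta>)
      (restriction (sipg J \<delta> (fine_mode J k d))) = coarse_mode J k z"
    by (metis inv_into_f_f)
  show ?thesis
    unfolding r_def[symmetric] z_def[symmetric]
    by (intro ext)
      (simp add: coarse_correction_def inv fine_mode_minus d
        prolongation_coarse_mode[OF z, of J k, folded e_def])
qed

text \<open>The factors 1/h^2 of \<open>A\<close> and of the smoother cancel, so the relaxation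
  enters only through the quotient \<alpha>/\<delta>.\<close>

lemma smoothing_op_fine_mode:
  assumes J: "J > 0" and c: "c \<in> carrier_vec 4" and \<delta>: "\<delta> \<noteq> 0"
  shows "smoothing_op J \<delta> k \<alpha> (fine_mode J k c) =
    fine_mode J k (c - of_real (\<alpha> / \<delta>) \<cdot>\<^sub>v (sipg_symbol \<delta> (phase J k) *\<^sub>v c))"
proof -
  define e where "e = phase J k"
  define C where "C = complex_of_real (1 / (mesh_size J)\<^sup>2)"
  have C: "C \<noteq> 0"
    using mesh_size_pos[OF J] by (simp add: C_def)
  have "complex_of_real (\<delta> / (mesh_size J)\<^sup>2) \<noteq> 0"
    using mesh_size_pos[OF J] \<delta> by simp
  then have "inj_on (cell_jacobi J \<delta>) (fine_space J k)"
    by (intro inj_onI ext) (metis cell_jacobi_def mult_left_cancel)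
  moreover have "cell_jacobi J \<delta> (fine_mode J k (of_real (1 / \<delta>) \<cdot>\<^sub>v (sipg_symbol \<delta> e *\<^sub>v c))) =
      sipg J \<delta> (fine_mode J k c)"
    using \<delta> by (intro ext) (simp add: cell_jacobi_def fine_mode_smult sipg_fine_mode[OF c] e_def)
  moreover have "fine_mode J k (of_real (1 / \<delta>) \<cdot>\<^sub>v (sipg_symbol \<delta> e *\<^sub>v c)) \<in> fine_space J k"
    by (simp add: fine_space_def)
  ultimately have inv: "inv_into (fine_space J k) (cell_jacobi J \<delta>) (sipg J \<delta> (fine_mode J k c)) =
      fine_mode J k (of_real (1 / \<delta>) \<cdot>\<^sub>v (sipg_symbol \<delta> e *\<^sub>v c))"
    by (metis inv_into_f_f)
  show ?thesis
    by (intro ext) (simp add: smoothing_op_def inv fine_mode_minus fine_mode_smult c flip: e_def)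
qed

section \<open>The matrix of the error operator, with \<omega> standing for
  \<alpha>/\<delta>\<close>

definition error_symbol :: "real \<Rightarrow> complex \<Rightarrow> real \<Rightarrow> complex mat" where
  "error_symbol \<delta> e \<omega> =
    (1\<^sub>m 4 - prolongation_symbol e * coarse_inverse_symbol \<delta> e * restriction_symbol e * sipg_symbol \<delta> e) *
    (1\<^sub>m 4 - of_real \<omega> \<cdot>\<^sub>m sipg_symbol \<delta> e)"

lemma error_symbol_carrier [simp]: "error_symbol \<delta> e \<omega> \<in> carrier_mat 4 4"
proof -
  have "1\<^sub>m 4 - of_real \<omega> \<cdot>\<^sub>m sipg_symbol \<delta> e \<in> carrier_mat 4 4"
    by (intro minus_carrier_mat smult_carrier_mat symbol_carrier)
  moreover have "1\<^sub>m 4 - prolongation_symbol e * coarse_inverse_symbol \<delta> e * restriction_symbol e *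
      sipg_symbol \<delta> e \<in> carrier_mat 4 4"
    by (rule minus_carrier_mat, rule mult_carrier_mat[OF _ symbol_carrier(1)],
        rule mult_carrier_mat[OF _ symbol_carrier(2)], rule mult_carrier_mat[OF symbol_carrier(3,4)])
  ultimately show ?thesis
    unfolding error_symbol_def by (rule mult_carrier_mat[rotated])
qed

lemma smult_mat_mult_vec:
  fixes a :: "'a :: comm_ring_1"
  assumes "A \<in> carrier_mat m n" and "v \<in> carrier_vec n"
  shows "(a \<cdot>\<^sub>m A) *\<^sub>v v = a \<cdot>\<^sub>v (A *\<^sub>v v)"
  using assms by (intro eq_vecI) (auto simp: smult_scalar_prod_distrib[of _ n])

lemma error_symbol_mult:
  fixes \<delta> \<omega> :: real and e :: complex and c :: "complex vec"
  assumes c: "c \<in> carrier_vec 4"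
  defines "d \<equiv> c - of_real \<omega> \<cdot>\<^sub>v (sipg_symbol \<delta> e *\<^sub>v c)"
  shows "error_symbol \<delta> e \<omega> *\<^sub>v c = d - prolongation_symbol e *\<^sub>v (coarse_inverse_symbol \<delta> e *\<^sub>v
      (restriction_symbol e *\<^sub>v (sipg_symbol \<delta> e *\<^sub>v d)))"
proof -
  let ?P = "prolongation_symbol e" and ?Z = "coarse_inverse_symbol \<delta> e"
  let ?R = "restriction_symbol e" and ?A = "sipg_symbol \<delta> e"
  have sm: "of_real \<omega> \<cdot>\<^sub>m ?A \<in> carrier_mat 4 4"
    by simp
  have PZ: "?P * ?Z \<in> carrier_mat 4 2" and PZR: "?P * ?Z * ?R \<in> carrier_mat 4 4"
    and PZRA: "?P * ?Z * ?R * ?A \<in> carrier_mat 4 4"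
    by (rule mult_carrier_mat; (rule mult_carrier_mat)?; (rule mult_carrier_mat)?; rule symbol_carrier)+
  have d: "d \<in> carrier_vec 4"
    using c by (simp add: d_def)
  have "(1\<^sub>m 4 - of_real \<omega> \<cdot>\<^sub>m ?A) *\<^sub>v c = d"
    using c by (simp add: d_def minus_mult_distrib_mat_vec[OF one_carrier_mat sm c]
        smult_mat_mult_vec[of ?A 4 4])
  then have "error_symbol \<delta> e \<omega> *\<^sub>v c = (1\<^sub>m 4 - ?P * ?Z * ?R * ?A) *\<^sub>v d"
    unfolding error_symbol_def
    by (subst assoc_mult_mat_vec[OF minus_carrier_mat[OF PZRA] minus_carrier_mat[OF sm] c]) simp
  also have "\<dots> = d - (?P * ?Z * ?R * ?A) *\<^sub>v d"
    using d by (simp add: minus_mult_distrib_mat_vec[OF one_carrier_mat PZRA d])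
  also have "(?P * ?Z * ?R * ?A) *\<^sub>v d = ?P *\<^sub>v (?Z *\<^sub>v (?R *\<^sub>v (?A *\<^sub>v d)))"
    by (simp only: assoc_mult_mat_vec[OF PZR symbol_carrier(1) d]
        assoc_mult_mat_vec[OF PZ symbol_carrier(2) symbol_mult_carrier(1)]
        assoc_mult_mat_vec[OF symbol_carrier(3,4) symbol_mult_carrier(2)])
  finally show ?thesis .
qed

lemma error_op_fine_mode:
  assumes "J > 0" and c: "c \<in> carrier_vec 4" and "\<delta> \<noteq> 0" and "coarse_det \<delta> (phase J k) \<noteq> 0"
  shows "error_op J \<delta> k \<alpha> (fine_mode J k c) =
    fine_mode J k (error_symbol \<delta> (phase J k) (\<alpha> / \<delta>) *\<^sub>v c)"
  using assms
  by (simp add: error_op_def smoothing_op_fine_mode coarse_correction_fine_mode error_symbol_mult)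

lemma error_matrix_eq:
  assumes "J > 0" and "\<delta> \<noteq> 0" and "coarse_det \<delta> (phase J k) \<noteq> 0"
  shows "error_matrix J \<delta> k \<alpha> = error_symbol \<delta> (phase J k) (\<alpha> / \<delta>)" (is "_ = ?L")
proof (rule eq_matI)
  have L: "?L \<in> carrier_mat 4 4" by simp
  then have dim: "dim_row ?L = 4" "dim_col ?L = 4" by (simp_all only: carrier_matD)
  fix p q assume "p < dim_row ?L" "q < dim_col ?L"
  then have pq: "p < 4" "q < 4" by (simp_all only: dim)
  have "inv_into (carrier_vec 4) (fine_mode J k) (error_op J \<delta> k \<alpha> (fine_mode J k (unit_vec 4 q))) =
      ?L *\<^sub>v unit_vec 4 q"
    using assms L
    by (simp add: error_op_fine_mode inv_into_f_f[OF inj_on_fine_mode] mult_mat_vec_carrier[OF L])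
  then show "error_matrix J \<delta> k \<alpha> $$ (p, q) = ?L $$ (p, q)"
    using pq L dim by (simp add: error_matrix_def scalar_prod_right_unit)
qed (auto simp: error_matrix_def carrier_matD[OF error_symbol_carrier])

section \<open>Eigenvalues\<close>

text \<open>Multiplying the system by the adjugate gives the determinant times each unknown, as in
  Cramer's rule but without division.\<close>

lemma det_zero_if_kernel:
  fixes x y :: "'a :: idom"
  assumes 1: "a * x + b * y = 0" and 2: "c * x + d * y = 0" and nz: "x \<noteq> 0 \<or> y \<noteq> 0"
  shows "a * d - b * c = 0"
proof -
  have "(a * d - b * c) * x = d * (a * x + b * y) - b * (c * x + d * y)"
    "(a * d - b * c) * y = a * (c * x + d * y) - c * (a * x + b * y)"
    by (simp_all add: algebra_simps)
  then show ?thesis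
    using nz by (auto simp: 1 2)
qed

lemma kernel_if_det_zero:
  fixes a b c d :: "'a :: idom"
  assumes "a * d - b * c = 0"
  obtains x y where "a * x + b * y = 0" "c * x + d * y = 0" "x \<noteq> 0 \<or> y \<noteq> 0"
proof -
  consider "a \<noteq> 0 \<or> b \<noteq> 0" | "c \<noteq> 0 \<or> d \<noteq> 0" | "a = 0" "b = 0" "c = 0" "d = 0" by blast
  then show thesis
  proof cases
    case 1
    \<comment> \<open>The vector orthogonal to a nonzero row solves the equation of that row; the
      other equation is the vanishing of the determinant.\<close>
    with assms show ?thesis by (intro that[of b "- a"]) (auto simp: algebra_simps)
  next
    case 2
    with assms show ?thesis by (intro that[of d "- c"]) (auto simp: algebra_simps)
  next
    case 3
    then show ?thesis by (intro that[of 1 0]) auto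
  qed
qed

text \<open>Up to the factor \<open>g\<^sup>2 - c\<^sup>2\<close>, the determinant of \<open>L\<close> times the compressed inverse of \<open>A\<close>
  minus \<open>\<omega>\<close>, where \<open>L = 1 - \<lambda>\<close> for an eigenvalue \<open>\<lambda>\<close>.\<close>

definition rate_poly :: "complex \<Rightarrow> complex \<Rightarrow> complex \<Rightarrow> complex \<Rightarrow> complex" where
  "rate_poly g c \<omega> L =
    (g + 1 - c\<^sup>2) * L\<^sup>2 - (g\<^sup>2 + 3 * g - (1 + g) * c\<^sup>2) * \<omega> * L + 2 * (g\<^sup>2 - c\<^sup>2) * \<omega>\<^sup>2"

text \<open>On the left is the determinant of the linear system for \<open>X\<close> and
  \<open>p\<close> to which the mode equations reduce in the next two lemmas. The factor
  \<open>q\<close> is the product of the eigenvalues \<open>g - c\<close> and \<open>g + c\<close>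
  of \<open>A\<close>.\<close>

lemma rate_poly_det:
  fixes c \<sigma> g \<omega> L :: complex
  assumes rel: "\<sigma>\<^sup>2 = c\<^sup>2 - 1"
  defines "q \<equiv> g\<^sup>2 - c\<^sup>2"
  shows "(L * g - \<omega> * q) * (L * (q - \<sigma>\<^sup>2 * g) - 2 * \<omega> * q) - (- L * \<sigma> * c) * (L * \<sigma> * c) =
    q * rate_poly g c \<omega> L"
proof -
  have "(- L * \<sigma> * c) * (L * \<sigma> * c) = - L\<^sup>2 * \<sigma>\<^sup>2 * c\<^sup>2"
    by (simp add: power2_eq_square algebra_simps)
  then show ?thesis
    unfolding rel rate_poly_def q_def by (simp add: power2_eq_square algebra_simps)
qed

text \<open>The variables \<open>p, m, p', m'\<close> are coordinates in which \<open>A\<close> is diagonal (see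
  \<open>symbols_in_wave_basis\<close>), \<open>n1, \<dots>, n4\<close> are those of the image under \<open>A\<close>, \<open>\<sigma>\<close> stands for the
  imaginary unit times the sine, and \<open>a, b\<close> are the coarse coordinates. The kernel of \<open>R\<close> is
  \<open>((1 - c) p, X - \<sigma> p, X + \<sigma> p, (1 + c) p)\<close>; pairing with its two basis vectors removes
  \<open>a\<close> and \<open>b\<close>.\<close>

lemma rate_poly_zero_if_mode:
  fixes c \<sigma> g \<omega> L p m p' m' a b :: complex
  defines "e \<equiv> c + \<sigma>" and "f \<equiv> c - \<sigma>"
  assumes rel: "\<sigma>\<^sup>2 = c\<^sup>2 - 1" and nz: "1 - c \<noteq> 0" "1 + c \<noteq> 0" "g - c \<noteq> 0" "g + c \<noteq> 0"
    and n: "n1 = (1 - c) * p" "n2 = (g - c) * m" "n3 = (g + c) * p'" "n4 = (1 + c) * m'"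
    and R: "f * (n1 + n2 - n3 - n4) + n1 + n4 = 0" "e * (n1 - n2 + n3 - n4) + n1 + n4 = 0"
    and P: "2 * (L * p - \<omega> * n1) = (e + 1) * a + (1 + f) * b" "2 * (L * m - \<omega> * n2) = e * a - f * b"
      "2 * (L * p' - \<omega> * n3) = f * b - e * a" "2 * (L * m' - \<omega> * n4) = (1 - e) * a + (1 - f) * b"
    and nontrivial: "p \<noteq> 0 \<or> m \<noteq> 0 \<or> p' \<noteq> 0 \<or> m' \<noteq> 0"
  shows "rate_poly g c \<omega> L = 0"
proof -
  define q where "q = g\<^sup>2 - c\<^sup>2"
  have ef: "e * f = 1"
    using rel by (simp add: e_def f_def algebra_simps power2_eq_square)
  have "e * (f * (n1 + n2 - n3 - n4) + n1 + n4) = (e * f) * (n1 + n2 - n3 - n4) + e * (n1 + n4)"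
    "f * (e * (n1 - n2 + n3 - n4) + n1 + n4) = (e * f) * (n1 - n2 + n3 - n4) + f * (n1 + n4)"
    by (simp_all add: algebra_simps)
  then have R': "n1 + n2 - n3 - n4 + e * (n1 + n4) = 0" "n1 - n2 + n3 - n4 + f * (n1 + n4) = 0"
    by (simp_all add: R ef)
  \<comment> \<open>Sum and difference of the two kernel conditions, simplified by
    \<open>e + f = 2 * c\<close> and \<open>e - f = 2 * \<sigma>\<close>, lead to the parameters
    \<open>p\<close> and \<open>X\<close> of the kernel of restriction.\<close>
  have "2 * ((1 + c) * n1) = 2 * ((1 - c) * n4)"
    using arg_cong2[OF R', of "(+)"] by (simp add: e_def f_def algebra_simps)
  then have mp: "m' = p"
    using nz by (simp add: n)
  have "2 * (n3 - n2) = 2 * (\<sigma> * (n1 + n4))"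
    using arg_cong2[OF R', of "(-)"] by (simp add: e_def f_def algebra_simps)
  then have "n3 - n2 = \<sigma> * (n1 + n4)"
    by (simp only: mult_cancel_left) simp
  also have "n1 + n4 = 2 * p"
    by (simp add: n mp algebra_simps)
  finally have n32: "n3 - n2 = 2 * \<sigma> * p" by simp
  define X where "X = (n2 + n3) / 2"
  have n2: "n2 = X - \<sigma> * p" and n3: "n3 = X + \<sigma> * p"
    using n32 by (simp_all add: X_def field_simps)
  have mq: "q * m = (g + c) * (X - \<sigma> * p)" "q * p' = (g - c) * (X + \<sigma> * p)"
    unfolding n2[symmetric] n3[symmetric] n q_def by (simp_all add: power2_eq_square algebra_simps)
  \<comment> \<open>The kernel direction of \<open>X\<close> is (0, 1, 1, 0): adding the two middle
    equations cancels \<open>a\<close> and \<open>b\<close>.\<close>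
  have "2 * (L * (m + p')) = 2 * (\<omega> * (n2 + n3))"
    using arg_cong2[OF P(2,3), of "(+)"] by (simp add: algebra_simps)
  then have "L * (m + p') = \<omega> * (n2 + n3)"
    by (simp only: mult_cancel_left) simp
  then have "q * (L * (m + p')) = q * (\<omega> * (2 * X))"
    by (simp add: n2 n3)
  then have "L * (q * m + q * p') = 2 * \<omega> * q * X"
    by (simp add: algebra_simps)
  then have "2 * ((L * g - \<omega> * q) * X + (- L * \<sigma> * c) * p) = 0"
    unfolding mq by (simp add: algebra_simps)
  then have eq1: "(L * g - \<omega> * q) * X + (- L * \<sigma> * c) * p = 0"
    by (simp only: mult_eq_0_iff) simp
  \<comment> \<open>Hermitian pairing with the kernel direction of \<open>p\<close>, where
    conjugation reverses the sign of the imaginary \<sigma>. The coarse coordinates drop out because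
    prolongation is adjoint to restriction, here in the form \<open>e * f = 1\<close>.\<close>
  have "2 * ((1 - c) * (L * p - \<omega> * n1) + \<sigma> * ((L * m - \<omega> * n2) - (L * p' - \<omega> * n3)) + (1 + c) * (L * m' - \<omega> * n4))
     = (1 - c) * ((e + 1) * a + (1 + f) * b) + \<sigma> * ((e * a - f * b) - (f * b - e * a)) + (1 + c) * ((1 - e) * a + (1 - f) * b)"
    unfolding P[symmetric] by (simp add: algebra_simps)
  also have "\<dots> = 2 * (1 - e * f) * a + 2 * (1 - e * f) * b"
    by (simp add: e_def f_def algebra_simps)
  also have "\<dots> = 0"
    by (simp add: ef)
  finally have "(1 - c) * (L * p - \<omega> * n1) + \<sigma> * ((L * m - \<omega> * n2) - (L * p' - \<omega> * n3)) + (1 + c) * (L * m' - \<omega> * n4) = 0"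
    by (simp only: mult_eq_0_iff) simp
  then have "L * (2 * p + \<sigma> * (m - p')) = \<omega> * ((1 - c) * n1 + \<sigma> * (n2 - n3) + (1 + c) * n4)"
    by (simp add: mp algebra_simps)
  also have "\<dots> = \<omega> * (2 + 2 * c\<^sup>2 - 2 * \<sigma>\<^sup>2) * p"
    unfolding n2 n3 by (simp add: n(1,4) mp algebra_simps power2_eq_square)
  finally have "L * (2 * p + \<sigma> * (m - p')) = 4 * \<omega> * p"
    by (simp add: rel)
  then have "q * (L * (2 * p + \<sigma> * (m - p'))) = q * (4 * \<omega> * p)"
    by simp
  then have "L * (2 * q * p + \<sigma> * (q * m - q * p')) = 4 * \<omega> * q * p"
    by (simp add: algebra_simps)
  then have "2 * ((L * \<sigma> * c) * X + (L * (q - \<sigma>\<^sup>2 * g) - 2 * \<omega> * q) * p) = 0"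
    unfolding mq by (simp add: power2_eq_square algebra_simps)
  then have eq2: "(L * \<sigma> * c) * X + (L * (q - \<sigma>\<^sup>2 * g) - 2 * \<omega> * q) * p = 0"
    by (simp only: mult_eq_0_iff) simp
  \<comment> \<open>If both vanished, so would the image under \<open>A\<close>, and with it all
    coordinates, since no eigenvalue of \<open>A\<close> is zero.\<close>
  have "X \<noteq> 0 \<or> p \<noteq> 0"
    using nontrivial n2 n3 n nz mp by auto
  from det_zero_if_kernel[OF eq1 eq2 this] have "q * rate_poly g c \<omega> L = 0"
    using rate_poly_det[OF rel, of L g \<omega>] by (simp add: q_def)
  moreover have "q = (g - c) * (g + c)"
    by (simp add: q_def power2_eq_square algebra_simps)
  ultimately show ?thesis
    using nz by simp
qed

text \<open>The previous argument read backwards: a solution \<open>X\<close>, \<open>p\<close> of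
  the singular system determines the image under \<open>A\<close>, division by the eigenvalues
  recovers the coordinates, and \<open>a\<close> and \<open>b\<close> are solved from part of the
  remaining equations. The two rows of the system yield the rest.\<close>

lemma mode_if_rate_poly_zero:
  fixes c \<sigma> g \<omega> L :: complex
  defines "e \<equiv> c + \<sigma>" and "f \<equiv> c - \<sigma>"
  assumes rel: "\<sigma>\<^sup>2 = c\<^sup>2 - 1" and nz: "1 - c \<noteq> 0" "1 + c \<noteq> 0" "g - c \<noteq> 0" "g + c \<noteq> 0"
    and zero: "rate_poly g c \<omega> L = 0"
  obtains p m p' m' a b n1 n2 n3 n4 where
    "n1 = (1 - c) * p" "n2 = (g - c) * m" "n3 = (g + c) * p'" "n4 = (1 + c) * m'"
    "f * (n1 + n2 - n3 - n4) + n1 + n4 = 0" "e * (n1 - n2 + n3 - n4) + n1 + n4 = 0"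
    "2 * (L * p - \<omega> * n1) = (e + 1) * a + (1 + f) * b" "2 * (L * m - \<omega> * n2) = e * a - f * b"
    "2 * (L * p' - \<omega> * n3) = f * b - e * a" "2 * (L * m' - \<omega> * n4) = (1 - e) * a + (1 - f) * b"
    "p \<noteq> 0 \<or> m \<noteq> 0 \<or> p' \<noteq> 0 \<or> m' \<noteq> 0"
proof -
  define q where "q = g\<^sup>2 - c\<^sup>2"
  have qf: "q = (g - c) * (g + c)"
    by (simp add: q_def power2_eq_square algebra_simps)
  then have q: "q \<noteq> 0"
    using nz by simp
  have ef: "e * f = 1"
    using rel by (simp add: e_def f_def algebra_simps power2_eq_square)
  have "(L * g - \<omega> * q) * (L * (q - \<sigma>\<^sup>2 * g) - 2 * \<omega> * q) - (- L * \<sigma> * c) * (L * \<sigma> * c) = 0"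
    using rate_poly_det[OF rel, of L g \<omega>] zero by (simp add: q_def)
  then obtain X p where eq1: "(L * g - \<omega> * q) * X + (- L * \<sigma> * c) * p = 0"
    and eq2: "(L * \<sigma> * c) * X + (L * (q - \<sigma>\<^sup>2 * g) - 2 * \<omega> * q) * p = 0"
    and Xp: "X \<noteq> 0 \<or> p \<noteq> 0"
    by (rule kernel_if_det_zero)
  define n1 n2 n3 n4 where "n1 = (1 - c) * p" and "n2 = X - \<sigma> * p" and "n3 = X + \<sigma> * p"
    and "n4 = (1 + c) * p"
  define m p' where "m = n2 / (g - c)" and "p' = n3 / (g + c)"
  have n: "n2 = (g - c) * m" "n3 = (g + c) * p'"
    using nz by (simp_all add: m_def p'_def)
  have mq: "q * m = (g + c) * (X - \<sigma> * p)" "q * p' = (g - c) * (X + \<sigma> * p)"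
    unfolding n2_def[symmetric] n3_def[symmetric] n qf by (simp_all add: algebra_simps)
  define u1 u2 u3 u4 where "u1 = L * p - \<omega> * n1" and "u2 = L * m - \<omega> * n2"
    and "u3 = L * p' - \<omega> * n3" and "u4 = L * p - \<omega> * n4"
  \<comment> \<open>Solution of \<open>e * a + f * b = u1 - u4\<close> and
    \<open>e * a - f * b = 2 * u2\<close>, where \<open>f\<close> is the inverse of
    \<open>e\<close>.\<close>
  define a b where "a = f * ((u1 - u4) / 2 + u2)" and "b = e * ((u1 - u4) / 2 - u2)"
  have "q * (u2 + u3) = L * (q * m + q * p') - 2 * \<omega> * q * X"
    by (simp add: u2_def u3_def n2_def n3_def algebra_simps)
  also have "\<dots> = 2 * ((L * g - \<omega> * q) * X + (- L * \<sigma> * c) * p)"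
    unfolding mq by (simp add: algebra_simps)
  finally have u3: "u3 = - u2"
    using eq1 q by (simp add: eq_neg_iff_add_eq_0 add.commute)
  have ss: "\<sigma> * (\<sigma> * t) = c\<^sup>2 * t - t" for t
    using rel by (simp add: power2_eq_square left_diff_distrib flip: mult.assoc)
  have "q * ((1 - c) * u1 + \<sigma> * (u2 - u3) + (1 + c) * u4) =
      L * (2 * q * p + \<sigma> * (q * m - q * p')) - \<omega> * q * (2 + 2 * c\<^sup>2 - 2 * \<sigma>\<^sup>2) * p"
    by (simp add: u1_def u2_def u3_def u4_def n1_def n2_def n3_def n4_def algebra_simps power2_eq_square)
  also have "\<dots> = 2 * ((L * \<sigma> * c) * X + (L * (q - \<sigma>\<^sup>2 * g) - 2 * \<omega> * q) * p)"
    unfolding mq rel by (simp add: algebra_simps ss)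
  finally have "q * ((1 - c) * u1 + \<sigma> * (u2 - u3) + (1 + c) * u4) = 0"
    by (simp only: eq2 mult_zero_right)
  then have "(1 - c) * u1 + \<sigma> * (u2 - u3) + (1 + c) * u4 = 0"
    using q by (simp only: mult_eq_0_iff) simp
  then have "(1 - c) * u1 + 2 * \<sigma> * u2 + (1 + c) * u4 = 0"
    by (simp add: u3 algebra_simps)
  then have u: "u1 + u4 = c * (u1 - u4) - 2 * \<sigma> * u2"
    by (simp add: algebra_simps eq_neg_iff_add_eq_0)
  have ea: "e * a = (u1 - u4) / 2 + u2"
    unfolding a_def by (simp only: mult.assoc[symmetric] ef) simp
  have fb: "f * b = (u1 - u4) / 2 - u2"
    unfolding b_def by (simp only: mult.assoc[symmetric] ef mult.commute[of f e]) simp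
  have "a + b = c * (u1 - u4) - 2 * \<sigma> * u2"
    by (simp add: a_def b_def e_def f_def field_simps)
  then have ab: "a + b = u1 + u4"
    by (simp only: u)
  show thesis
  proof (rule that[of n1 p n2 m n3 p' n4 p a b])
    show "f * (n1 + n2 - n3 - n4) + n1 + n4 = 0" "e * (n1 - n2 + n3 - n4) + n1 + n4 = 0"
    proof -
      have "f * (n1 + n2 - n3 - n4) + n1 + n4 = 2 * p * (1 - e * f)"
        "e * (n1 - n2 + n3 - n4) + n1 + n4 = 2 * p * (1 - e * f)"
        by (simp_all add: n1_def n2_def n3_def n4_def e_def f_def algebra_simps)
      then show "f * (n1 + n2 - n3 - n4) + n1 + n4 = 0" "e * (n1 - n2 + n3 - n4) + n1 + n4 = 0"
        by (simp_all add: ef)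
    qed
    have "(e + 1) * a + (1 + f) * b = e * a + f * b + (a + b)"
      "(1 - e) * a + (1 - f) * b = (a + b) - (e * a + f * b)"
      by (simp_all add: algebra_simps)
    then show "2 * (L * p - \<omega> * n1) = (e + 1) * a + (1 + f) * b"
      "2 * (L * p - \<omega> * n4) = (1 - e) * a + (1 - f) * b"
      "2 * (L * m - \<omega> * n2) = e * a - f * b" "2 * (L * p' - \<omega> * n3) = f * b - e * a"
      unfolding ea fb ab u1_def[symmetric] u2_def[symmetric] u3_def[symmetric] u4_def[symmetric]
      by (simp_all add: u3)
    show "p \<noteq> 0 \<or> m \<noteq> 0 \<or> p' \<noteq> 0 \<or> p \<noteq> 0"
      using Xp n nz by (auto simp: n2_def n3_def)
  qed (use n in \<open>simp_all add: n1_def n4_def\<close>)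
qed

section \<open>Eigenvalues of the error symbol\<close>

text \<open>Invertibility of the coarse operator at the admissible frequencies: the determinant has
  the factor \<open>1 - (Re e)\<^sup>2\<close>, which vanishes exactly at the excluded ones.\<close>

lemma coarse_det_pos:
  assumes "e * cnj e = 1" and "(Re e)\<^sup>2 < 1" and "\<delta> \<ge> 1"
  shows "coarse_det \<delta> e > 0"
proof -
  have "(Re e)\<^sup>2 + (Im e)\<^sup>2 = 1"
    using assms(1) by (simp add: complex_eq_iff power2_eq_square)
  then have Re: "Re (e\<^sup>2) = 2 * (Re e)\<^sup>2 - 1"
    by (simp add: power2_eq_square)
  have "coarse_det \<delta> e = (1 - (Re e)\<^sup>2) * (2 * \<delta> - (Re e)\<^sup>2)"
    unfolding coarse_det_def Re by (simp add: power2_eq_square field_simps)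
  then show ?thesis
    using assms by simp
qed

text \<open>Restriction after \<open>A\<close> annihilates the range of the coarse correction, so it
  annihilates eigenvectors for nonzero eigenvalues; the eigenvalue equation is then a congruence
  modulo the range of prolongation. Conversely, the correction removes exactly the coarse part
  \<open>z\<close>.\<close>

lemma error_symbol_eigenvector_iff:
  fixes \<omega> \<delta> :: real and \<mu> e :: complex
  assumes v: "v \<in> carrier_vec 4" and e: "e * cnj e = 1" and det: "coarse_det \<delta> e \<noteq> 0" and \<mu>: "\<mu> \<noteq> 0"
  defines "n \<equiv> sipg_symbol \<delta> e *\<^sub>v v"
  shows "error_symbol \<delta> e \<omega> *\<^sub>v v = \<mu> \<cdot>\<^sub>v v \<longleftrightarrow>
    restriction_symbol e *\<^sub>v n = 0\<^sub>v 2 \<and>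
    (\<exists>z\<in>carrier_vec 2. (1 - \<mu>) \<cdot>\<^sub>v v - of_real \<omega> \<cdot>\<^sub>v n = prolongation_symbol e *\<^sub>v z)"
proof -
  let ?P = "prolongation_symbol e" and ?Z = "coarse_inverse_symbol \<delta> e"
  let ?R = "restriction_symbol e" and ?A = "sipg_symbol \<delta> e"
  define d where "d = v - of_real \<omega> \<cdot>\<^sub>v n"
  define r where "r = ?R *\<^sub>v (?A *\<^sub>v d)"
  have n: "n \<in> carrier_vec 4" and d: "d \<in> carrier_vec 4" and r: "r \<in> carrier_vec 2"
    using v by (simp_all add: n_def d_def r_def)
  have smult_zero: "a \<cdot>\<^sub>v 0\<^sub>v 2 = 0\<^sub>v 2" for a :: complex
    by (intro eq_vecI) simp_all
  have E: "error_symbol \<delta> e \<omega> *\<^sub>v v = d - ?P *\<^sub>v (?Z *\<^sub>v r)"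
    using error_symbol_mult[OF v] by (simp add: d_def r_def n_def)
  show ?thesis
  proof (intro iffI conjI)
    assume eig: "error_symbol \<delta> e \<omega> *\<^sub>v v = \<mu> \<cdot>\<^sub>v v"
    have "\<mu> \<cdot>\<^sub>v (?R *\<^sub>v n) = ?R *\<^sub>v (?A *\<^sub>v (d - ?P *\<^sub>v (?Z *\<^sub>v r)))"
      using v n by (simp add: E[symmetric] eig n_def mult_mat_vec[OF symbol_carrier(1)]
          mult_mat_vec[OF symbol_carrier(2)])
    also have "\<dots> = r - ?R *\<^sub>v (?A *\<^sub>v (?P *\<^sub>v (?Z *\<^sub>v r)))"
      using d by (simp add: r_def mult_minus_distrib_mat_vec[OF symbol_carrier(1)]
          mult_minus_distrib_mat_vec[OF symbol_carrier(2)])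
    also have "\<dots> = 0\<^sub>v 2"
      using r by (simp add: coarse_symbol_inverse(1)[OF r e det])
    finally have "(1 / \<mu>) \<cdot>\<^sub>v (\<mu> \<cdot>\<^sub>v (?R *\<^sub>v n)) = (1 / \<mu>) \<cdot>\<^sub>v 0\<^sub>v 2" by simp
    also have "\<dots> = 0\<^sub>v 2" by (rule smult_zero)
    finally have "(1 / \<mu>) \<cdot>\<^sub>v (\<mu> \<cdot>\<^sub>v (?R *\<^sub>v n)) = 0\<^sub>v 2" .
    then show "?R *\<^sub>v n = 0\<^sub>v 2"
      using \<mu> by (simp add: smult_smult_assoc)
    have dP: "d - ?P *\<^sub>v (?Z *\<^sub>v r) = \<mu> \<cdot>\<^sub>v v"
      using E eig by simp
    have "(1 - \<mu>) \<cdot>\<^sub>v v - of_real \<omega> \<cdot>\<^sub>v n = ?P *\<^sub>v (?Z *\<^sub>v r)"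
    proof (rule eq_vecI)
      fix i assume "i < dim_vec (?P *\<^sub>v (?Z *\<^sub>v r))"
      then have i: "i < 4" by (simp add: carrier_matD[OF symbol_carrier(3)])
      have "(d - ?P *\<^sub>v (?Z *\<^sub>v r)) $ i = (\<mu> \<cdot>\<^sub>v v) $ i"
        by (simp only: dP)
      then show "((1 - \<mu>) \<cdot>\<^sub>v v - of_real \<omega> \<cdot>\<^sub>v n) $ i = (?P *\<^sub>v (?Z *\<^sub>v r)) $ i"
        using i v n carrier_vecD[OF symbol_mult_carrier(3)]
        by (simp add: d_def algebra_simps del: index_mult_mat_vec)
    qed (use v n in \<open>simp add: carrier_matD[OF symbol_carrier(3)]\<close>)
    then show "\<exists>z\<in>carrier_vec 2. (1 - \<mu>) \<cdot>\<^sub>v v - of_real \<omega> \<cdot>\<^sub>v n = ?P *\<^sub>v z"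
      by (meson symbol_mult_carrier(4))
  next
    assume "?R *\<^sub>v n = 0\<^sub>v 2 \<and> (\<exists>z\<in>carrier_vec 2. (1 - \<mu>) \<cdot>\<^sub>v v - of_real \<omega> \<cdot>\<^sub>v n = ?P *\<^sub>v z)"
    then obtain z where Rn: "?R *\<^sub>v n = 0\<^sub>v 2" and z: "z \<in> carrier_vec 2"
      and Pz: "(1 - \<mu>) \<cdot>\<^sub>v v - of_real \<omega> \<cdot>\<^sub>v n = ?P *\<^sub>v z"
      by blast
    have d': "d = \<mu> \<cdot>\<^sub>v v + ?P *\<^sub>v z"
      unfolding Pz[symmetric] using v n
      by (intro eq_vecI) (simp_all add: d_def algebra_simps)
    have "r = \<mu> \<cdot>\<^sub>v (?R *\<^sub>v n) + ?R *\<^sub>v (?A *\<^sub>v (?P *\<^sub>v z))"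
      unfolding r_def d' n_def using v
      by (simp add: mult_add_distrib_mat_vec[OF symbol_carrier(1)]
          mult_add_distrib_mat_vec[OF symbol_carrier(2)] mult_mat_vec[OF symbol_carrier(1)]
          mult_mat_vec[OF symbol_carrier(2)])
    then have "r = ?R *\<^sub>v (?A *\<^sub>v (?P *\<^sub>v z))"
      by (simp add: Rn smult_zero)
    then have "?Z *\<^sub>v r = z"
      using coarse_symbol_inverse(2)[OF z e det] by simp
    then show "error_symbol \<delta> e \<omega> *\<^sub>v v = \<mu> \<cdot>\<^sub>v v"
      unfolding E d' using v z
      by (intro eq_vecI) (simp_all add: carrier_vecD[OF symbol_mult_carrier(3)] del: index_mult_mat_vec dim_mult_mat_vec)
  qed
qed

text \<open>The two nonzero blocks of the symbol of \<open>A\<close> have the eigenvectors \<open>(1, e)\<close> and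
  \<open>(1, - e)\<close>.\<close>

lemma symbols_in_wave_basis:
  fixes \<delta> :: real and e :: complex
  assumes e: "e * cnj e = 1"
  defines "f \<equiv> cnj e" and "c \<equiv> complex_of_real (Re e)" and "g \<equiv> complex_of_real (2 * \<delta> - 1)"
  shows "v \<in> carrier_vec 4 \<Longrightarrow> n = sipg_symbol \<delta> e *\<^sub>v v \<Longrightarrow>
      n $ 0 + f * n $ 1 = (1 - c) * (v $ 0 + f * v $ 1) \<and>
      n $ 0 - f * n $ 1 = (g - c) * (v $ 0 - f * v $ 1) \<and>
      n $ 2 + f * n $ 3 = (g + c) * (v $ 2 + f * v $ 3) \<and>
      n $ 2 - f * n $ 3 = (1 + c) * (v $ 2 - f * v $ 3)"
    and "n \<in> carrier_vec 4 \<Longrightarrow> n1 = n $ 0 + f * n $ 1 \<Longrightarrow> n2 = n $ 0 - f * n $ 1 \<Longrightarrow>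
      n3 = n $ 2 + f * n $ 3 \<Longrightarrow> n4 = n $ 2 - f * n $ 3 \<Longrightarrow>
      4 * (restriction_symbol e *\<^sub>v n) $ 0 = f * (n1 + n2 - n3 - n4) + n1 + n4 \<and>
      4 * (restriction_symbol e *\<^sub>v n) $ 1 = e * (n1 - n2 + n3 - n4) + n1 + n4"
    and "z \<in> carrier_vec 2 \<Longrightarrow> u = prolongation_symbol e *\<^sub>v z \<Longrightarrow>
      2 * (u $ 0 + f * u $ 1) = (e + 1) * z $ 0 + (1 + f) * z $ 1 \<and>
      2 * (u $ 0 - f * u $ 1) = e * z $ 0 - f * z $ 1 \<and>
      2 * (u $ 2 + f * u $ 3) = f * z $ 1 - e * z $ 0 \<and>
      2 * (u $ 2 - f * u $ 3) = (1 - e) * z $ 0 + (1 - f) * z $ 1"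
proof -
  have ef: "e * f = 1"
    using e by (simp add: f_def)
  have fe: "f * (e * t) = t" for t
    using ef by (metis mult.assoc mult.commute mult_1)
  have fe': "f * (a * (e * t)) = a * t" for a t
    by (simp only: mult.left_commute[of f a] fe)
  have ef': "e * (f * t) = t" for t
    using ef by (metis mult.assoc mult_1)
  have ef1: "f * e = 1"
    using ef by (simp add: mult.commute)
  show "n $ 0 + f * n $ 1 = (1 - c) * (v $ 0 + f * v $ 1) \<and>
      n $ 0 - f * n $ 1 = (g - c) * (v $ 0 - f * v $ 1) \<and>
      n $ 2 + f * n $ 3 = (g + c) * (v $ 2 + f * v $ 3) \<and>
      n $ 2 - f * n $ 3 = (1 + c) * (v $ 2 - f * v $ 3)"
    if v: "v \<in> carrier_vec 4" and n: "n = sipg_symbol \<delta> e *\<^sub>v v"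
    unfolding n using v
    by (simp add: sipg_symbol_mult g_def c_def flip: f_def)
      (simp add: ring_distribs mult.assoc fe fe')
  show "4 * (restriction_symbol e *\<^sub>v n) $ 0 = f * (n1 + n2 - n3 - n4) + n1 + n4 \<and>
      4 * (restriction_symbol e *\<^sub>v n) $ 1 = e * (n1 - n2 + n3 - n4) + n1 + n4"
    if "n \<in> carrier_vec 4" "n1 = n $ 0 + f * n $ 1" "n2 = n $ 0 - f * n $ 1"
      "n3 = n $ 2 + f * n $ 3" "n4 = n $ 2 - f * n $ 3"
    using that(1) unfolding that(2-)
    by (simp add: restriction_symbol_mult flip: f_def) (simp add: algebra_simps ef')
  show "2 * (u $ 0 + f * u $ 1) = (e + 1) * z $ 0 + (1 + f) * z $ 1 \<and>
      2 * (u $ 0 - f * u $ 1) = e * z $ 0 - f * z $ 1 \<and>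
      2 * (u $ 2 + f * u $ 3) = f * z $ 1 - e * z $ 0 \<and>
      2 * (u $ 2 - f * u $ 3) = (1 - e) * z $ 0 + (1 - f) * z $ 1"
    if z: "z \<in> carrier_vec 2" and u: "u = prolongation_symbol e *\<^sub>v z"
    unfolding u using z
    by (simp add: prolongation_symbol_mult flip: f_def)
      (simp add: ring_distribs mult.assoc fe fe' ef1)
qed

text \<open>Zero is always an eigenvalue, because the coarse correction annihilates the
  two-dimensional range of prolongation. Only nonzero values are therefore characterised by the rate
  polynomial.\<close>

lemma eigenvalue_error_symbol:
  fixes \<omega> \<delta> :: real and \<mu> e :: complex
  assumes e: "e * cnj e = 1" and c: "(Re e)\<^sup>2 < 1" and \<delta>: "\<delta> \<ge> 1" and \<mu>: "\<mu> \<noteq> 0"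
  shows "eigenvalue (error_symbol \<delta> e \<omega>) \<mu> \<longleftrightarrow>
    rate_poly (of_real (2 * \<delta> - 1)) (of_real (Re e)) (of_real \<omega>) (1 - \<mu>) = 0"
proof -
  define f c g \<sigma> where "f = cnj e" and "c = complex_of_real (Re e)"
    and "g = complex_of_real (2 * \<delta> - 1)" and "\<sigma> = \<i> * complex_of_real (Im e)"
  have det: "coarse_det \<delta> e \<noteq> 0"
    using coarse_det_pos[OF e c \<delta>] by simp
  have e': "e = c + \<sigma>" and f': "f = c - \<sigma>"
    by (simp_all add: f_def c_def \<sigma>_def complex_eq_iff)
  have ef: "e * f = 1"
    using e by (simp add: f_def)
  then have rel: "\<sigma>\<^sup>2 = c\<^sup>2 - 1"
    by (simp add: e' f' algebra_simps power2_eq_square)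
  have Re: "\<bar>Re e\<bar> < 1"
    using c by (simp add: abs_square_less_1)
  have nz: "1 - c \<noteq> 0" "1 + c \<noteq> 0" "g - c \<noteq> 0" "g + c \<noteq> 0"
    using Re \<delta> by (auto simp: c_def g_def complex_eq_iff)
  note basis = symbols_in_wave_basis[OF e, folded f_def c_def]
  have dim: "dim_row (error_symbol \<delta> e \<omega>) = 4"
    by (rule carrier_matD[OF error_symbol_carrier])
  show ?thesis
  proof
    assume "eigenvalue (error_symbol \<delta> e \<omega>) \<mu>"
    then obtain v where v: "v \<in> carrier_vec 4" "v \<noteq> 0\<^sub>v 4"
      and eig: "error_symbol \<delta> e \<omega> *\<^sub>v v = \<mu> \<cdot>\<^sub>v v"
      by (auto simp: eigenvalue_def eigenvector_def dim)
    define n where "n = sipg_symbol \<delta> e *\<^sub>v v"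
    have n: "n \<in> carrier_vec 4" by (simp add: n_def)
    obtain z where Rn: "restriction_symbol e *\<^sub>v n = 0\<^sub>v 2" and z: "z \<in> carrier_vec 2"
      and Pz: "(1 - \<mu>) \<cdot>\<^sub>v v - of_real \<omega> \<cdot>\<^sub>v n = prolongation_symbol e *\<^sub>v z"
      using eig error_symbol_eigenvector_iff[OF v(1) e det \<mu>] by (auto simp: n_def)
    define u where "u = (1 - \<mu>) \<cdot>\<^sub>v v - of_real \<omega> \<cdot>\<^sub>v n"
    have u: "u $ i = (1 - \<mu>) * v $ i - of_real \<omega> * n $ i" if "i < 4" for i
      using that v n by (simp add: u_def)
    have P: "2 * (u $ 0 + f * u $ 1) = (e + 1) * z $ 0 + (1 + f) * z $ 1"
      "2 * (u $ 0 - f * u $ 1) = e * z $ 0 - f * z $ 1"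
      "2 * (u $ 2 + f * u $ 3) = f * z $ 1 - e * z $ 0"
      "2 * (u $ 2 - f * u $ 3) = (1 - e) * z $ 0 + (1 - f) * z $ 1"
      using basis(3)[OF z, of u] Pz by (simp_all only: u_def)
    have N: "n $ 0 + f * n $ 1 = (1 - c) * (v $ 0 + f * v $ 1)"
      "n $ 0 - f * n $ 1 = (g - c) * (v $ 0 - f * v $ 1)"
      "n $ 2 + f * n $ 3 = (g + c) * (v $ 2 + f * v $ 3)"
      "n $ 2 - f * n $ 3 = (1 + c) * (v $ 2 - f * v $ 3)"
      using basis(1)[OF v(1) n_def] by (simp_all only: g_def)
    have R: "f * ((n $ 0 + f * n $ 1) + (n $ 0 - f * n $ 1) - (n $ 2 + f * n $ 3) - (n $ 2 - f * n $ 3)) +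
         (n $ 0 + f * n $ 1) + (n $ 2 - f * n $ 3) = 0"
      "e * ((n $ 0 + f * n $ 1) - (n $ 0 - f * n $ 1) + (n $ 2 + f * n $ 3) - (n $ 2 - f * n $ 3)) +
         (n $ 0 + f * n $ 1) + (n $ 2 - f * n $ 3) = 0"
      using basis(2)[OF n refl refl refl refl] by (simp_all add: Rn)
    show "rate_poly (of_real (2 * \<delta> - 1)) (of_real (Re e)) (of_real \<omega>) (1 - \<mu>) = 0"
      unfolding g_def[symmetric] c_def[symmetric]
    proof (rule rate_poly_zero_if_mode[of \<sigma> c g, folded e' f', OF rel nz N R])
      show "2 * ((1 - \<mu>) * (v $ 0 + f * v $ 1) - of_real \<omega> * (n $ 0 + f * n $ 1)) =
          (e + 1) * z $ 0 + (1 + f) * z $ 1"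
        using P(1) by (simp add: u algebra_simps)
      show "2 * ((1 - \<mu>) * (v $ 0 - f * v $ 1) - of_real \<omega> * (n $ 0 - f * n $ 1)) =
          e * z $ 0 - f * z $ 1"
        using P(2) by (simp add: u algebra_simps)
      show "2 * ((1 - \<mu>) * (v $ 2 + f * v $ 3) - of_real \<omega> * (n $ 2 + f * n $ 3)) =
          f * z $ 1 - e * z $ 0"
        using P(3) by (simp add: u algebra_simps)
      show "2 * ((1 - \<mu>) * (v $ 2 - f * v $ 3) - of_real \<omega> * (n $ 2 - f * n $ 3)) =
          (1 - e) * z $ 0 + (1 - f) * z $ 1"
        using P(4) by (simp add: u algebra_simps)
      show "v $ 0 + f * v $ 1 \<noteq> 0 \<or> v $ 0 - f * v $ 1 \<noteq> 0 \<or> v $ 2 + f * v $ 3 \<noteq> 0 \<or> v $ 2 - f * v $ 3 \<noteq> 0"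
      proof (rule ccontr)
        assume "\<not> ?thesis"
        then have *: "v $ 0 + f * v $ 1 = 0" "v $ 0 - f * v $ 1 = 0" "v $ 2 + f * v $ 3 = 0"
          "v $ 2 - f * v $ 3 = 0" by auto
        have f0: "f \<noteq> 0" using ef by auto
        have "v $ 0 = 0" "v $ 2 = 0"
          using arg_cong2[OF *(1,2), of "(+)"] arg_cong2[OF *(3,4), of "(+)"] by simp_all
        moreover from this have "v $ 1 = 0" "v $ 3 = 0"
          using * f0 by simp_all
        ultimately have "v = 0\<^sub>v 4"
          by (intro vec4_eqI[OF v(1)]) simp_all
        with v show False by simp
      qed
    qed
  next
    assume "rate_poly (of_real (2 * \<delta> - 1)) (of_real (Re e)) (of_real \<omega>) (1 - \<mu>) = 0"
    then have "rate_poly g c (of_real \<omega>) (1 - \<mu>) = 0"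
      by (simp only: g_def c_def)
    then obtain p m p' m' a b n1 n2 n3 n4 where
      N: "n1 = (1 - c) * p" "n2 = (g - c) * m" "n3 = (g + c) * p'" "n4 = (1 + c) * m'" and
      R: "f * (n1 + n2 - n3 - n4) + n1 + n4 = 0" "e * (n1 - n2 + n3 - n4) + n1 + n4 = 0" and
      P: "2 * ((1 - \<mu>) * p - of_real \<omega> * n1) = (e + 1) * a + (1 + f) * b"
        "2 * ((1 - \<mu>) * m - of_real \<omega> * n2) = e * a - f * b"
        "2 * ((1 - \<mu>) * p' - of_real \<omega> * n3) = f * b - e * a"
        "2 * ((1 - \<mu>) * m' - of_real \<omega> * n4) = (1 - e) * a + (1 - f) * b" and
      nontrivial: "p \<noteq> 0 \<or> m \<noteq> 0 \<or> p' \<noteq> 0 \<or> m' \<noteq> 0"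
      by (rule mode_if_rate_poly_zero[OF rel nz, folded e' f'])
    \<comment> \<open>Inverts the passage to the wave coordinates \<open>v $ 0 + f * v $ 1\<close>,
      \<open>v $ 0 - f * v $ 1\<close> and their analogues for the second block.\<close>
    define v where "v = vec 4 (\<lambda>i. [(p + m) / 2, e * ((p - m) / 2), (p' + m') / 2, e * ((p' - m') / 2)] ! i)"
    have v: "v \<in> carrier_vec 4" by (simp add: v_def)
    have fe: "f * (e * t) = t" for t
      using ef by (metis mult.assoc mult.commute mult_1)
    have vi: "v $ 0 + f * v $ 1 = p" "v $ 0 - f * v $ 1 = m" "v $ 2 + f * v $ 3 = p'" "v $ 2 - f * v $ 3 = m'"
      by (simp_all add: v_def fe del: times_divide_eq_right) (simp_all add: field_simps)
    define n where "n = sipg_symbol \<delta> e *\<^sub>v v"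
    have n: "n \<in> carrier_vec 4" by (simp add: n_def)
    have ni: "n $ 0 + f * n $ 1 = n1" "n $ 0 - f * n $ 1 = n2" "n $ 2 + f * n $ 3 = n3" "n $ 2 - f * n $ 3 = n4"
      using basis(1)[OF v n_def] by (simp_all only: N vi g_def)
    have "restriction_symbol e *\<^sub>v n = 0\<^sub>v 2"
      using basis(2)[OF n ni[symmetric]] R by (intro vec2_eqI) simp_all
    moreover have "(1 - \<mu>) \<cdot>\<^sub>v v - of_real \<omega> \<cdot>\<^sub>v n = prolongation_symbol e *\<^sub>v vec 2 (\<lambda>i. [a, b] ! i)"
    proof -
      define z where "z = vec 2 (\<lambda>i. [a, b] ! i)"
      have z: "z \<in> carrier_vec 2" "z $ 0 = a" "z $ 1 = b" by (simp_all add: z_def)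
      define u where "u = (1 - \<mu>) \<cdot>\<^sub>v v - of_real \<omega> \<cdot>\<^sub>v n"
      define w where "w = prolongation_symbol e *\<^sub>v z"
      have u: "u $ i = (1 - \<mu>) * v $ i - of_real \<omega> * n $ i" if "i < 4" for i
        using that v n by (simp add: u_def)
      have u': "u $ 0 + f * u $ 1 = (1 - \<mu>) * p - of_real \<omega> * n1" "u $ 0 - f * u $ 1 = (1 - \<mu>) * m - of_real \<omega> * n2"
        "u $ 2 + f * u $ 3 = (1 - \<mu>) * p' - of_real \<omega> * n3" "u $ 2 - f * u $ 3 = (1 - \<mu>) * m' - of_real \<omega> * n4"
        unfolding vi[symmetric] ni[symmetric] by (simp_all add: u algebra_simps)
      have "2 * (u $ 0 + f * u $ 1) = 2 * (w $ 0 + f * w $ 1)" "2 * (u $ 0 - f * u $ 1) = 2 * (w $ 0 - f * w $ 1)"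
        "2 * (u $ 2 + f * u $ 3) = 2 * (w $ 2 + f * w $ 3)" "2 * (u $ 2 - f * u $ 3) = 2 * (w $ 2 - f * w $ 3)"
        using basis(3)[OF z(1) w_def] by (simp_all only: u' P z)
      then have uw: "u $ 0 + f * u $ 1 = w $ 0 + f * w $ 1" "u $ 0 - f * u $ 1 = w $ 0 - f * w $ 1"
        "u $ 2 + f * u $ 3 = w $ 2 + f * w $ 3" "u $ 2 - f * u $ 3 = w $ 2 - f * w $ 3"
        by (simp_all only: mult_cancel_left) simp_all
      have f0: "f \<noteq> 0" using ef by auto
      have 02: "u $ 0 = w $ 0" "u $ 2 = w $ 2"
        using arg_cong2[OF uw(1,2), of "(+)"] arg_cong2[OF uw(3,4), of "(+)"] by simp_all
      have 13: "u $ 1 = w $ 1" "u $ 3 = w $ 3"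
        using uw(1,3) f0 by (simp_all add: 02)
      have "u = w"
        by (rule vec4_eqI[OF _ _ 02(1) 13(1) 02(2) 13(2)]) (use v n in \<open>simp_all add: u_def w_def\<close>)
      then show ?thesis by (simp only: u_def w_def z_def)
    qed
    moreover have "vec 2 (\<lambda>i. [a, b] ! i) \<in> carrier_vec 2" by simp
    ultimately have "error_symbol \<delta> e \<omega> *\<^sub>v v = \<mu> \<cdot>\<^sub>v v"
      using error_symbol_eigenvector_iff[OF v e det \<mu>, of \<omega>] unfolding n_def by blast
    moreover have "v \<noteq> 0\<^sub>v 4"
    proof
      assume "v = 0\<^sub>v 4"
      with vi have "p = 0" "m = 0" "p' = 0" "m' = 0" by simp_all
      with nontrivial show False by simp
    qed
    ultimately show "eigenvalue (error_symbol \<delta> e \<omega>) \<mu>"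
      using v by (auto simp: eigenvalue_def eigenvector_def dim)
  qed
qed

section \<open>The range of the rates\<close>

text \<open>Discriminant of \<open>rate_poly\<close> at \<omega> = 1 with
  \<open>x = c\<^sup>2\<close>, arranged so that it is visibly nonnegative for \<open>x\<close>
  between 0 and 1: the rates are real.\<close>

definition rate_disc :: "real \<Rightarrow> real \<Rightarrow> real" where
  "rate_disc g x = (g + g * x - g\<^sup>2 + x)\<^sup>2 + 8 * x * (1 - x)"

definition rate :: "real \<Rightarrow> real \<Rightarrow> real \<Rightarrow> real" where
  "rate s g x = (g\<^sup>2 + 3 * g - (1 + g) * x + s * sqrt (rate_disc g x)) / (2 * (g + 1 - x))"

lemma rate_disc_nonneg: "0 \<le> x \<Longrightarrow> x \<le> 1 \<Longrightarrow> rate_disc g x \<ge> 0"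
  by (simp add: rate_disc_def)

text \<open>Sum and product of the two rates are the coefficients, by Vieta. The polynomial is
  homogeneous in \<open>L\<close> and \<omega>, so its roots are \<omega> times the rates.\<close>

lemma rate_poly_factor:
  fixes L :: complex
  assumes x: "c\<^sup>2 \<le> 1" and g: "g \<ge> 1"
  shows "rate_poly (of_real g) (of_real c) (of_real \<omega>) L =
    of_real (g + 1 - c\<^sup>2) * (L - of_real (\<omega> * rate 1 g (c\<^sup>2))) * (L - of_real (\<omega> * rate (-1) g (c\<^sup>2)))"
proof -
  define x where "x = c\<^sup>2"
  define a where "a = g + 1 - x"
  have a: "a > 0" using x g by (simp add: a_def x_def)
  define T where "T = g\<^sup>2 + 3 * g - (1 + g) * x"
  have r: "rate 1 g x = (T + sqrt (rate_disc g x)) / (2 * a)" "rate (-1) g x = (T - sqrt (rate_disc g x)) / (2 * a)"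
    by (simp_all add: rate_def T_def a_def)
  have sum: "a * (rate 1 g x + rate (-1) g x) = T"
    using a unfolding r by (simp add: field_simps)
  have D: "(sqrt (rate_disc g x))\<^sup>2 = T\<^sup>2 - 8 * a * (g\<^sup>2 - x)"
  proof -
    have "(sqrt (rate_disc g x))\<^sup>2 = rate_disc g x"
      using rate_disc_nonneg[of x g] x by (simp add: x_def)
    then show ?thesis
      by (simp add: rate_disc_def T_def a_def power2_eq_square algebra_simps)
  qed
  have "a * (a * (rate 1 g x * rate (-1) g x)) = (T\<^sup>2 - (sqrt (rate_disc g x))\<^sup>2) / 4"
    using a unfolding r by (simp add: power2_eq_square field_simps)
  also have "\<dots> = a * (2 * (g\<^sup>2 - x))"
    unfolding D by simp
  finally have prod: "a * (rate 1 g x * rate (-1) g x) = 2 * (g\<^sup>2 - x)"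
    using a by simp
  have "of_real a * (L - of_real (\<omega> * rate 1 g x)) * (L - of_real (\<omega> * rate (-1) g x)) =
      of_real a * L\<^sup>2 - of_real (a * (rate 1 g x + rate (-1) g x)) * of_real \<omega> * L +
      of_real (a * (rate 1 g x * rate (-1) g x)) * (of_real \<omega>)\<^sup>2"
    by (simp add: power2_eq_square algebra_simps)
  also have "\<dots> = rate_poly (of_real g) (of_real c) (of_real \<omega>) L"
    unfolding sum prod by (simp add: rate_poly_def a_def T_def x_def)
  finally show ?thesis
    by (simp add: a_def x_def)
qed

text \<open>The quadratic equation of the rates, rearranged as a convex combination of its cases
  \<open>x = 0\<close> and \<open>x = 1\<close>. These have the roots \<open>g\<close>,
  \<open>2 * g / (g + 1)\<close> and \<open>2\<close>, \<open>g - 1 / g\<close>.\<close>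

lemma rate_root:
  assumes "0 \<le> x" "x \<le> 1" "g \<ge> 1" "s\<^sup>2 = 1"
  defines "\<mu> \<equiv> rate s g x"
  shows "(1 - x) * ((\<mu> - g) * ((g + 1) * \<mu> - 2 * g)) + x * ((\<mu> - 2) * (g * \<mu> - (g\<^sup>2 - 1))) = 0"
proof -
  define a where "a = g + 1 - x"
  have a: "a > 0" using assms by (simp add: a_def)
  define T where "T = g\<^sup>2 + 3 * g - (1 + g) * x"
  have "2 * a * \<mu> - T = s * sqrt (rate_disc g x)"
    using a by (simp add: \<mu>_def rate_def a_def[symmetric] T_def[symmetric])
  then have "(2 * a * \<mu> - T)\<^sup>2 = rate_disc g x"
    using assms rate_disc_nonneg[of x g] by (simp add: power_mult_distrib)
  also have "\<dots> = T\<^sup>2 - 8 * a * (g\<^sup>2 - x)"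
    by (simp add: rate_disc_def T_def a_def power2_eq_square algebra_simps)
  finally have "4 * a * (a * \<mu>\<^sup>2 - T * \<mu> + 2 * (g\<^sup>2 - x)) = 0"
    by (simp add: power2_eq_square algebra_simps)
  then have "a * \<mu>\<^sup>2 - T * \<mu> + 2 * (g\<^sup>2 - x) = 0"
    using a by simp
  then show ?thesis
    by (simp add: a_def T_def power2_eq_square algebra_simps)
qed

section \<open>Extreme values of the rates\<close>

text \<open>To the right of all four roots both quadratics are positive, and so is their convex
  combination.\<close>

lemma rate_le:
  assumes x: "0 \<le> x" "x \<le> 1" and g: "g \<ge> 1" and s: "s\<^sup>2 = 1"
  shows "rate s g x \<le> max 2 g"
proof (rule ccontr)
  let ?\<mu> = "rate s g x"
  assume "\<not> ?thesis"
  then have \<mu>: "?\<mu> > 2" "?\<mu> > g" by auto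
  have "(g + 1) * ?\<mu> > (g + 1) * 2"
    using \<mu> g by (intro mult_strict_left_mono) auto
  then have 1: "(?\<mu> - g) * ((g + 1) * ?\<mu> - 2 * g) > 0"
    using \<mu> g by (intro mult_pos_pos) auto
  have "g * ?\<mu> > g * g"
    using \<mu> g by (intro mult_strict_left_mono) auto
  then have "g * ?\<mu> - (g\<^sup>2 - 1) > 0"
    unfolding power2_eq_square by linarith
  then have 2: "(?\<mu> - 2) * (g * ?\<mu> - (g\<^sup>2 - 1)) > 0"
    using \<mu> by simp
  have "(1 - x) * ((?\<mu> - g) * ((g + 1) * ?\<mu> - 2 * g)) + x * ((?\<mu> - 2) * (g * ?\<mu> - (g\<^sup>2 - 1))) > 0"
  \<comment> \<open>At \<open>x = 0\<close> the first term is positive by itself; otherwise the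
    second quadratic has positive weight.\<close>
  proof (cases "x = 0")
    case False
    then show ?thesis
      using x by (intro add_nonneg_pos[OF mult_nonneg_nonneg[OF _ less_imp_le[OF 1]] mult_pos_pos[OF _ 2]]) auto
  qed (use 1 in simp)
  with rate_root[OF x g s] show False by simp
qed

text \<open>Both quadratics are positive to the left of all their roots. The estimates
  \<open>a\<close> place the two larger roots \<open>g\<close> and \<open>2\<close> beyond the
  bound.\<close>

lemma rate_ge:
  assumes x: "0 \<le> x" "x \<le> 1" and g: "g \<ge> 1" and s: "s\<^sup>2 = 1"
  shows "rate s g x \<ge> min (2 * g / (g + 1)) (g - 1 / g)"
proof (rule ccontr)
  let ?\<mu> = "rate s g x"
  assume "\<not> ?thesis"
  then have \<mu>: "?\<mu> < 2 * g / (g + 1)" "?\<mu> < g - 1 / g" by auto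
  have a: "2 * g / (g + 1) \<le> g" "2 * g / (g + 1) \<le> 2"
    using g by (simp_all add: field_simps)
  have "(g + 1) * ?\<mu> < 2 * g"
    using \<mu>(1) g by (simp add: field_simps)
  then have 1: "(?\<mu> - g) * ((g + 1) * ?\<mu> - 2 * g) > 0"
    using \<mu> a by (intro mult_neg_neg) auto
  have "g * ?\<mu> < g\<^sup>2 - 1"
    using \<mu>(2) g by (simp add: field_simps power2_eq_square)
  then have 2: "(?\<mu> - 2) * (g * ?\<mu> - (g\<^sup>2 - 1)) > 0"
    using \<mu> a by (intro mult_neg_neg) auto
  have "(1 - x) * ((?\<mu> - g) * ((g + 1) * ?\<mu> - 2 * g)) + x * ((?\<mu> - 2) * (g * ?\<mu> - (g\<^sup>2 - 1))) > 0"
  proof (cases "x = 0")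
    case False
    then show ?thesis
      using x by (intro add_nonneg_pos[OF mult_nonneg_nonneg[OF _ less_imp_le[OF 1]] mult_pos_pos[OF _ 2]]) auto
  qed (use 1 in simp)
  with rate_root[OF x g s] show False by simp
qed

text \<open>At \<open>x = 0\<close> and \<open>x = 1\<close> the discriminant is a perfect square,
  so the rates are rational in \<open>g\<close>.\<close>

lemma rate_endpoint_values:
  assumes g: "g \<ge> 1" and v: "v \<in> {g, 2 * g / (g + 1), 2, g - 1 / g}"
  shows "\<exists>s x. s\<^sup>2 = 1 \<and> (x = 0 \<or> x = 1) \<and> rate s g x = v"
proof -
  have "rate_disc g 0 = (g\<^sup>2 - g)\<^sup>2"
    by (simp add: rate_disc_def power2_eq_square algebra_simps)
  moreover have "g\<^sup>2 - g \<ge> 0"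
    using g by (simp add: power2_eq_square)
  ultimately have s0: "sqrt (rate_disc g 0) = g\<^sup>2 - g"
    by simp
  have "rate_disc g 1 = (2 * g + 1 - g\<^sup>2)\<^sup>2"
    by (simp add: rate_disc_def algebra_simps)
  then have s1: "sqrt (rate_disc g 1) = \<bar>2 * g + 1 - g\<^sup>2\<bar>"
    by simp
  have 0: "rate 1 g 0 = g" "rate (-1) g 0 = 2 * g / (g + 1)"
    using g by (simp_all add: rate_def s0 divide_simps) (simp_all add: power2_eq_square algebra_simps)
  \<comment> \<open>Which branch of the square root yields 2 depends on the sign of the expression
    under the absolute value.\<close>
  define t :: real where "t = (if 2 * g + 1 - g\<^sup>2 \<ge> 0 then 1 else -1)"
  have t: "t\<^sup>2 = 1" "t * \<bar>2 * g + 1 - g\<^sup>2\<bar> = 2 * g + 1 - g\<^sup>2"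
    by (simp_all add: t_def)
  have 1: "rate t g 1 = 2" "rate (- t) g 1 = g - 1 / g"
    using g by (simp_all add: rate_def s1 t divide_simps) (simp_all add: power2_eq_square algebra_simps)
  show ?thesis
    using v 0 1 t(1) by (auto intro: exI[of _ "1::real"] exI[of _ "-1::real"] exI[of _ t] exI[of _ "- t"])
qed

section \<open>Frequencies and spectral radii\<close>

lemma phase_frequency:
  assumes J: "J > 0" and k: "k \<in> frequencies J"
  shows "(Re (phase J k))\<^sup>2 < 1"
proof -
  define t where "t = 2 * k / real J"
  define \<theta> where "\<theta> = pi * t"
  have "- 1 < t" "t < 1" "t \<noteq> 0"
    using J k by (auto simp: t_def frequencies_def field_simps)
  then have "- pi < \<theta>" "\<theta> < pi" "\<theta> \<noteq> 0"
    using mult_strict_left_mono[OF \<open>- 1 < t\<close> pi_gt_zero] by (simp_all add: \<theta>_def)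
  have "sin \<theta> \<noteq> 0"
  proof
    assume "sin \<theta> = 0"
    then show False
      using sin_gt_zero[of \<theta>] sin_gt_zero[of "- \<theta>"] \<open>- pi < \<theta>\<close> \<open>\<theta> < pi\<close> \<open>\<theta> \<noteq> 0\<close>
      by (cases "\<theta> > 0") auto
  qed
  then have "(cos \<theta>)\<^sup>2 < 1"
    using sin_cos_squared_add[of \<theta>] by (smt (verit) zero_less_power2)
  then show ?thesis
    by (simp add: phase_def \<theta>_def t_def mesh_size_def mult.left_commute mult.commute)
qed

text \<open>Since \<open>k\<close> is a real variable, every \<open>x\<close> below 1 occurs for
  each \<open>J\<close>; this is why the supremum does not depend on the mesh. The value 1 would
  require an excluded frequency.\<close>

lemma exists_frequency:
  assumes J: "J > 0" and x: "0 \<le> x" "x < 1"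
  shows "\<exists>k\<in>frequencies J. (Re (phase J k))\<^sup>2 = x"
proof -
  define \<theta> where "\<theta> = arccos (sqrt x)"
  define k where "k = real J * \<theta> / (2 * pi)"
  have sq: "sqrt x < 1" using x by simp
  have \<theta>: "0 < \<theta>" "\<theta> \<le> pi / 2"
    using x sq arccos_lt_bounded[of "sqrt x"] arccos_le_pi2[of "sqrt x"]
    unfolding \<theta>_def by (smt (verit) real_sqrt_ge_zero)+
  then have "\<theta> < pi" using pi_gt_zero by linarith
  then have "real J * \<theta> < real J * pi"
    using J by simp
  then have "0 < k" "k < real J / 2"
    using J \<theta> by (simp_all add: k_def field_simps)
  then have "k \<in> frequencies J"
    by (auto simp: frequencies_def)
  moreover have "phase J k = cis \<theta>"
    using J by (simp add: phase_def k_def mesh_size_def)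
  moreover have "cos \<theta> = sqrt x"
    unfolding \<theta>_def by (rule cos_arccos) (use x sq in \<open>smt (verit) real_sqrt_ge_zero\<close>)+
  ultimately show ?thesis
    using x by (intro bexI[of _ k]) simp_all
qed

lemma spectral_radius_eigenvalue:
  assumes "A \<in> carrier_mat n n" and "eigenvalue A \<mu>"
  shows "norm \<mu> \<le> spectral_radius A"
  using assms card_finite_spectrum(1)[OF assms(1)] unfolding spectral_radius_def spectrum_def
  by (intro Max_ge) auto

lemma spectral_radius_le:
  assumes A: "A \<in> carrier_mat n n" "n > 0" and "\<And>\<mu>. eigenvalue A \<mu> \<Longrightarrow> norm \<mu> \<le> B"
  shows "spectral_radius A \<le> B"
  using assms card_finite_spectrum(1)[OF A(1)] spectrum_non_empty[OF A] unfolding spectral_radius_def spectrum_def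
  by (subst Max_le_iff) auto

lemma spectral_radius_error_matrix:
  assumes J: "J > 0" and \<delta>: "\<delta> \<ge> 1" and k: "k \<in> frequencies J"
  defines "x \<equiv> (Re (phase J k))\<^sup>2" and "g \<equiv> 2 * \<delta> - 1"
  shows "spectral_radius (error_matrix J \<delta> k \<alpha>) =
    max \<bar>1 - \<alpha> / \<delta> * rate 1 g x\<bar> \<bar>1 - \<alpha> / \<delta> * rate (-1) g x\<bar>"
proof -
  define e where "e = phase J k"
  define \<omega> where "\<omega> = \<alpha> / \<delta>"
  let ?A = "error_symbol \<delta> e \<omega>"
  have e: "e * cnj e = 1" and c: "(Re e)\<^sup>2 < 1"
    using phase_frequency[OF J k] by (simp_all add: e_def)
  have g: "g \<ge> 1" using \<delta> by (simp add: g_def)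
  have A: "error_matrix J \<delta> k \<alpha> = ?A"
    using error_matrix_eq[OF J, of \<delta> k \<alpha>] coarse_det_pos[OF e c \<delta>] \<delta> by (simp add: e_def \<omega>_def)
  have eig: "eigenvalue ?A \<mu> \<longleftrightarrow>
      \<mu> = of_real (1 - \<omega> * rate 1 g x) \<or> \<mu> = of_real (1 - \<omega> * rate (-1) g x)" if "\<mu> \<noteq> 0" for \<mu>
  proof -
    have "complex_of_real (g + 1 - x) \<noteq> 0"
      using g c by (auto simp: x_def e_def simp del: of_real_diff of_real_add)
    moreover have "eigenvalue ?A \<mu> \<longleftrightarrow> rate_poly (of_real g) (of_real (Re e)) (of_real \<omega>) (1 - \<mu>) = 0"
      unfolding g_def by (rule eigenvalue_error_symbol[OF e c \<delta> that])
    ultimately have "eigenvalue ?A \<mu> \<longleftrightarrow>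
        1 - \<mu> = of_real (\<omega> * rate 1 g x) \<or> 1 - \<mu> = of_real (\<omega> * rate (-1) g x)"
      using rate_poly_factor[of "Re e" g \<omega> "1 - \<mu>"] c g
      by (simp add: x_def e_def del: of_real_diff of_real_add of_real_mult)
    then show ?thesis
      by (auto simp: algebra_simps)
  qed
  have nonneg: "spectral_radius ?A \<ge> 0"
  proof -
    obtain \<mu> where "eigenvalue ?A \<mu>"
      using spectrum_non_empty[of ?A 4] by (auto simp: spectrum_def)
    with spectral_radius_eigenvalue[OF error_symbol_carrier this] show ?thesis
      using norm_ge_zero order_trans by blast
  qed
  \<comment> \<open>Only nonzero eigenvalues have been characterised, so the value 0 is settled by
    nonnegativity of the spectral radius.\<close>
  have ge: "\<bar>t\<bar> \<le> spectral_radius ?A" if "t = 1 - \<omega> * rate 1 g x \<or> t = 1 - \<omega> * rate (-1) g x" for t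
  proof (cases "t = 0")
    case False
    then have "eigenvalue ?A (of_real t)"
      using eig[of "of_real t"] that by auto
    from spectral_radius_eigenvalue[OF error_symbol_carrier this] show ?thesis
      by simp
  qed (use nonneg in simp)
  have "spectral_radius ?A \<le> max \<bar>1 - \<omega> * rate 1 g x\<bar> \<bar>1 - \<omega> * rate (-1) g x\<bar>"
  proof (rule spectral_radius_le[OF error_symbol_carrier])
    fix \<mu> assume "eigenvalue ?A \<mu>"
    then have "\<mu> = 0 \<or> \<mu> = of_real (1 - \<omega> * rate 1 g x) \<or> \<mu> = of_real (1 - \<omega> * rate (-1) g x)"
      using eig by blast
    then show "norm \<mu> \<le> max \<bar>1 - \<omega> * rate 1 g x\<bar> \<bar>1 - \<omega> * rate (-1) g x\<bar>"
      by (elim disjE) (simp_all only: norm_of_real norm_zero max.cobounded1 max.cobounded2 le_max_iff_disj abs_ge_zero simp_thms)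
  qed simp
  then show ?thesis
    unfolding A using ge[of "1 - \<omega> * rate 1 g x"] ge[of "1 - \<omega> * rate (-1) g x"]
    by (simp add: \<omega>_def)
qed

text \<open>For \<open>x = 1\<close> no admissible frequency exists; the bound is obtained as a
  limit from the left by continuity of the rates.\<close>

lemma rho_ge:
  assumes J: "J > 0" and \<delta>: "\<delta> \<ge> 1" and s: "s\<^sup>2 = 1" and x: "0 \<le> x" "x \<le> 1"
  shows "ereal \<bar>1 - \<alpha> / \<delta> * rate s (2 * \<delta> - 1) x\<bar> \<le> rho J \<delta> \<alpha>"
proof -
  define g where "g = 2 * \<delta> - 1"
  have g: "g \<ge> 1" using \<delta> by (simp add: g_def)
  have s': "s = 1 \<or> s = -1" using s by (simp add: power2_eq_1_iff)
  have less: "ereal \<bar>1 - \<alpha> / \<delta> * rate s g y\<bar> \<le> rho J \<delta> \<alpha>" if y: "0 \<le> y" "y < 1" for y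
  proof -
    obtain k where k: "k \<in> frequencies J" and ky: "(Re (phase J k))\<^sup>2 = y"
      using exists_frequency[OF J y] by blast
    have "\<bar>1 - \<alpha> / \<delta> * rate s g y\<bar> \<le> spectral_radius (error_matrix J \<delta> k \<alpha>)"
      using spectral_radius_error_matrix[OF J \<delta> k, of \<alpha>] s' by (auto simp: ky g_def)
    also have "ereal \<dots> \<le> rho J \<delta> \<alpha>"
      unfolding rho_def by (rule SUP_upper[OF k])
    finally show ?thesis by simp
  qed
  show ?thesis
  proof (cases "x < 1")
    case True
    with less x show ?thesis by (simp add: g_def)
  next
    case False
    have "((\<lambda>y. \<bar>1 - \<alpha> / \<delta> * rate s g y\<bar>) \<longlongrightarrow> \<bar>1 - \<alpha> / \<delta> * rate s g 1\<bar>) (at_left 1)"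
      unfolding rate_def rate_disc_def using g by (intro tendsto_intros) auto
    then have "((\<lambda>y. ereal \<bar>1 - \<alpha> / \<delta> * rate s g y\<bar>) \<longlongrightarrow> ereal \<bar>1 - \<alpha> / \<delta> * rate s g 1\<bar>) (at_left 1)"
      by (rule tendsto_ereal)
    moreover have "eventually (\<lambda>y. ereal \<bar>1 - \<alpha> / \<delta> * rate s g y\<bar> \<le> rho J \<delta> \<alpha>) (at_left 1)"
      using eventually_at_left_real[of 0 "1 :: real", simplified] by (rule eventually_mono) (rule less; simp)
    ultimately have "ereal \<bar>1 - \<alpha> / \<delta> * rate s g 1\<bar> \<le> rho J \<delta> \<alpha>"
      by (rule tendsto_upperbound) simp
    with False x show ?thesis by (simp add: g_def)
  qed
qed

text \<open>The function \<open>\<bar>1 - \<omega> * \<mu>\<bar>\<close> is convex in \<mu>, so on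
  the range of the rates it is largest at an extreme rate. Both extreme rates are endpoint values,
  which \<open>rho_ge\<close> covers.\<close>

lemma rho_eq:
  assumes J: "J > 0" and \<delta>: "\<delta> \<ge> 1"
  defines "g \<equiv> 2 * \<delta> - 1"
  defines "m \<equiv> min (2 * g / (g + 1)) (g - 1 / g)" and "M \<equiv> max 2 g"
  shows "rho J \<delta> \<alpha> = ereal (max \<bar>1 - \<alpha> / \<delta> * m\<bar> \<bar>1 - \<alpha> / \<delta> * M\<bar>)"
proof (rule antisym)
  have g: "g \<ge> 1" using \<delta> by (simp add: g_def)
  show "rho J \<delta> \<alpha> \<le> ereal (max \<bar>1 - \<alpha> / \<delta> * m\<bar> \<bar>1 - \<alpha> / \<delta> * M\<bar>)"
    unfolding rho_def
  proof (rule SUP_least)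
    fix k assume k: "k \<in> frequencies J"
    define x where "x = (Re (phase J k))\<^sup>2"
    have x: "0 \<le> x" "x \<le> 1"
      using phase_frequency[OF J k] by (simp_all add: x_def)
    have "\<bar>1 - \<alpha> / \<delta> * rate s g x\<bar> \<le> max \<bar>1 - \<alpha> / \<delta> * m\<bar> \<bar>1 - \<alpha> / \<delta> * M\<bar>" if "s\<^sup>2 = 1" for s
    proof -
      have "m \<le> rate s g x" "rate s g x \<le> M"
        unfolding m_def M_def using rate_ge[OF x g that] rate_le[OF x g that] by simp_all
      then show ?thesis
        using mult_left_mono[of m "rate s g x" "\<alpha> / \<delta>"] mult_left_mono[of "rate s g x" M "\<alpha> / \<delta>"]
          mult_left_mono_neg[of m "rate s g x" "\<alpha> / \<delta>"] mult_left_mono_neg[of "rate s g x" M "\<alpha> / \<delta>"]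
        by (cases "\<alpha> / \<delta> \<ge> 0") linarith+
    qed
    then have "spectral_radius (error_matrix J \<delta> k \<alpha>) \<le> max \<bar>1 - \<alpha> / \<delta> * m\<bar> \<bar>1 - \<alpha> / \<delta> * M\<bar>"
      unfolding spectral_radius_error_matrix[OF J \<delta> k, of \<alpha>] x_def[symmetric] g_def[symmetric]
      by (intro max.boundedI) (simp_all only: power_one power2_minus)
    then show "ereal (spectral_radius (error_matrix J \<delta> k \<alpha>)) \<le> ereal (max \<bar>1 - \<alpha> / \<delta> * m\<bar> \<bar>1 - \<alpha> / \<delta> * M\<bar>)"
      by (simp only: ereal_less_eq)
  qed
  have "ereal \<bar>1 - \<alpha> / \<delta> * v\<bar> \<le> rho J \<delta> \<alpha>" if "v \<in> {g, 2 * g / (g + 1), 2, g - 1 / g}" for v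
  proof -
    obtain s x where s: "s\<^sup>2 = 1" and x: "x = 0 \<or> x = 1" and v: "rate s g x = v"
      using rate_endpoint_values[OF g \<open>v \<in> _\<close>] by blast
    have "0 \<le> x" "x \<le> 1" using x by auto
    from rho_ge[OF J \<delta> s this, of \<alpha>] show ?thesis
      using v by (simp add: g_def)
  qed
  from this[of m] this[of M] show "ereal (max \<bar>1 - \<alpha> / \<delta> * m\<bar> \<bar>1 - \<alpha> / \<delta> * M\<bar>) \<le> rho J \<delta> \<alpha>"
    unfolding m_def M_def min_def max_def by (auto split: if_splits)
qed

section \<open>The optimal relaxation parameter\<close>

text \<open>Equioscillation: with \<omega> = \<alpha>/\<delta> the optimum balances
  \<open>1 - \<omega> * m\<close> against \<open>\<omega> * M - 1\<close>. For positive
  \<open>m\<close> any other \<omega> enlarges one of them; for \<open>m = 0\<close> the first is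
  constant and uniqueness is lost.\<close>

lemma rho_optimal:
  fixes m M \<delta> :: real
  assumes rho: "\<And>\<alpha>. rho J \<delta> \<alpha> = ereal (max \<bar>1 - \<alpha> / \<delta> * m\<bar> \<bar>1 - \<alpha> / \<delta> * M\<bar>)"
    and m: "0 \<le> m" "m \<le> M" "0 < M" and \<delta>: "\<delta> > 0"
  shows "is_arg_min (rho J \<delta>) (\<lambda>_. True) (2 * \<delta> / (m + M))"
    and "m > 0 \<Longrightarrow> is_arg_min (rho J \<delta>) (\<lambda>_. True) \<alpha> \<Longrightarrow> \<alpha> = 2 * \<delta> / (m + M)"
proof -
  define F where "F \<alpha> = max \<bar>1 - \<alpha> / \<delta> * m\<bar> \<bar>1 - \<alpha> / \<delta> * M\<bar>" for \<alpha>
  have rho': "rho J \<delta> = (\<lambda>\<alpha>. ereal (F \<alpha>))"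
    using rho by (simp add: F_def fun_eq_iff)
  have "1 - 2 * \<delta> / (m + M) / \<delta> * m = (M - m) / (m + M)" "1 - 2 * \<delta> / (m + M) / \<delta> * M = - ((M - m) / (m + M))"
  proof -
    have 1: "2 * \<delta> / (m + M) / \<delta> = 2 / (m + M)" and 2: "m + M \<noteq> 0"
      using m \<delta> by simp_all
    show "1 - 2 * \<delta> / (m + M) / \<delta> * m = (M - m) / (m + M)"
      "1 - 2 * \<delta> / (m + M) / \<delta> * M = - ((M - m) / (m + M))"
      unfolding 1 using 2 by (simp_all add: divide_simps)
  qed
  then have opt: "F (2 * \<delta> / (m + M)) = (M - m) / (m + M)"
    using m by (simp add: F_def)
  have bounds: "1 - \<alpha> / \<delta> * m \<le> F \<alpha>" "\<alpha> / \<delta> * M - 1 \<le> F \<alpha>" for \<alpha>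
    using abs_ge_self[of "1 - \<alpha> / \<delta> * m"] abs_ge_minus_self[of "1 - \<alpha> / \<delta> * M"]
    by (simp_all add: F_def le_max_iff_disj)
  have lower: "(M - m) / (m + M) \<le> F \<alpha>" for \<alpha>
  proof -
    let ?\<omega> = "\<alpha> / \<delta>"
    \<comment> \<open>the weights \<open>M\<close> and \<open>m\<close> cancel \<open>?\<omega>\<close>\<close>
    have "M - m = M * (1 - ?\<omega> * m) + m * (?\<omega> * M - 1)"
      by (simp add: algebra_simps)
    also have "\<dots> \<le> M * F \<alpha> + m * F \<alpha>"
      using m bounds[of \<alpha>] by (intro add_mono mult_left_mono) simp_all
    finally show ?thesis
      using m by (simp add: divide_le_eq algebra_simps)
  qed
  show min: "is_arg_min (rho J \<delta>) (\<lambda>_. True) (2 * \<delta> / (m + M))"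
    unfolding is_arg_min_def rho' by (auto simp: opt not_less lower)
  assume pos: "m > 0" and arg: "is_arg_min (rho J \<delta>) (\<lambda>_. True) \<alpha>"
  then have "F \<alpha> \<le> (M - m) / (m + M)"
    unfolding is_arg_min_def rho' by (auto simp: not_less simp flip: opt)
  then have "1 - \<alpha> / \<delta> * m \<le> (M - m) / (m + M)" "\<alpha> / \<delta> * M - 1 \<le> (M - m) / (m + M)"
    using bounds[of \<alpha>] by linarith+
  moreover have "(M - m) / (m + M) = 1 - 2 / (m + M) * m" "(M - m) / (m + M) = 2 / (m + M) * M - 1"
    using m by (simp_all add: field_simps)
  ultimately have "2 / (m + M) * m \<le> \<alpha> / \<delta> * m" "\<alpha> / \<delta> * M \<le> 2 / (m + M) * M"
    by linarith+
  then have "\<alpha> / \<delta> = 2 / (m + M)"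
    using pos m by (meson antisym mult_right_le_imp_le)
  then show "\<alpha> = 2 * \<delta> / (m + M)"
    using \<delta> by (simp add: field_simps)
qed

section \<open>The threshold \<open>delta_plus\<close> as a cubic root\<close>

text \<open>Cardano's formula: \<open>t\<close> is the tribonacci constant. With \<open>a\<close>
  and \<open>b\<close> the two cube roots, \<open>a * b = 4\<close> turns the expansion of
  \<open>(a + b) ^ 3\<close> into a cubic equation for the sum.\<close>

lemma cubic_delta_plus:
  defines "t \<equiv> 2 * delta_plus - 1"
  shows "t ^ 3 = t\<^sup>2 + t + 1" and "t > 1"
proof -
  define a b where "a = root 3 (19 - 3 * sqrt 33)" and "b = root 3 (19 + 3 * sqrt 33)"
  have s: "sqrt 33 > 5" "sqrt 33 < 6"
    by (simp_all add: real_less_rsqrt real_less_lsqrt)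
  have a3: "a ^ 3 = 19 - 3 * sqrt 33" and b3: "b ^ 3 = 19 + 3 * sqrt 33"
    by (simp_all add: a_def b_def odd_real_root_pow)
  \<comment> \<open>Extracting the cube root of 8 exposes the conjugate pair of cube roots.\<close>
  have "152 - 24 * sqrt 33 = 8 * (19 - 3 * sqrt 33)"
    by simp
  then have "root 3 (152 - 24 * sqrt 33) = root 3 8 * a"
    unfolding a_def by (simp only: real_root_mult)
  also have "root 3 8 = 2"
    by (rule real_root_pos_unique) simp_all
  finally have t: "t = (1 + (a + b)) / 3"
    by (simp add: t_def delta_plus_def b_def)
  have "a * b = root 3 ((19 - 3 * sqrt 33) * (19 + 3 * sqrt 33))"
    by (simp only: a_def b_def real_root_mult)
  also have "(19 - 3 * sqrt 33) * (19 + 3 * sqrt 33) = 64"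
    by (simp add: algebra_simps)
  also have "root 3 64 = 4"
    by (rule real_root_pos_unique) simp_all
  finally have ab: "a * b = 4" .
  have "(a + b) ^ 3 = a ^ 3 + b ^ 3 + 3 * (a * b) * (a + b)"
    by (simp add: power3_eq_cube algebra_simps)
  then have ab3: "(a + b) ^ 3 = 12 * (a + b) + 38"
    by (simp add: a3 b3 ab)
  have "27 * (t ^ 3 - (t\<^sup>2 + t + 1)) = (a + b) ^ 3 - 12 * (a + b) - 38"
    unfolding t by (simp add: power3_eq_cube power2_eq_square field_simps)
  then show "t ^ 3 = t\<^sup>2 + t + 1"
    by (simp add: ab3)
  have "a > 0"
    using s by (simp add: a_def)
  moreover have "b \<ge> root 3 8"
    using s unfolding b_def by (intro real_root_le_mono) simp_all
  ultimately show "t > 1"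
    using \<open>root 3 8 = 2\<close> by (simp add: t)
qed

text \<open>The cubic vanishes at \<open>t\<close>, so \<open>g - t\<close> splits off; the quotient
  \<open>q\<close> is positive for \<open>g\<close> and \<open>t\<close> in this range.\<close>

lemma cubic_sign:
  fixes g t :: real
  assumes t: "t ^ 3 = t\<^sup>2 + t + 1" "t > 1" and g: "g \<ge> 1"
  shows "g \<le> t \<longleftrightarrow> g ^ 3 \<le> g\<^sup>2 + g + 1" and "t \<le> g \<longleftrightarrow> g\<^sup>2 + g + 1 \<le> g ^ 3"
proof -
  define q where "q = g\<^sup>2 + g * t + t\<^sup>2 - g - t - 1"
  have "g * 1 \<le> g * g" "t * 1 \<le> t * t" "1 * 1 < g * t"
    using t g by (intro mult_left_mono, simp_all) (smt (verit) mult_less_cancel_left2 mult_le_cancel_right1)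
  then have q: "q > 0"
    by (simp add: q_def power2_eq_square)
  have "g ^ 3 - (g\<^sup>2 + g + 1) = (g - t) * q + (t ^ 3 - (t\<^sup>2 + t + 1))"
    by (simp add: q_def power3_eq_cube power2_eq_square algebra_simps)
  then have eq: "g ^ 3 - (g\<^sup>2 + g + 1) = (g - t) * q"
    using t by simp
  show "g \<le> t \<longleftrightarrow> g ^ 3 \<le> g\<^sup>2 + g + 1"
    using eq q mult_le_0_iff[of "g - t" q] by linarith
  show "t \<le> g \<longleftrightarrow> g\<^sup>2 + g + 1 \<le> g ^ 3"
    using eq q zero_le_mult_iff[of "g - t" q] by linarith
qed

theorem theorem5p2:
  fixes J :: nat and \<delta>\<^sub>0 :: real
  assumes "J > 0" and "even J" and "\<delta>\<^sub>0 \<ge> 1"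
  shows "(1 \<le> \<delta>\<^sub>0 \<and> \<delta>\<^sub>0 \<le> delta_plus \<longrightarrow>
            is_arg_min (rho J \<delta>\<^sub>0) (\<lambda>_. True)
              (\<delta>\<^sub>0 * (2 * \<delta>\<^sub>0 - 1) / (2 * \<delta>\<^sub>0\<^sup>2 - 1)))
       \<and> (delta_plus \<le> \<delta>\<^sub>0 \<and> \<delta>\<^sub>0 \<le> delta_minus \<longrightarrow>
            is_arg_min (rho J \<delta>\<^sub>0) (\<lambda>_. True)
              (2 * \<delta>\<^sub>0\<^sup>2 * (2 * \<delta>\<^sub>0 - 1) /
                (\<delta>\<^sub>0 * \<bar>2 * \<delta>\<^sub>0\<^sup>2 - 4 * \<delta>\<^sub>0 + 1\<bar> + 2 * \<delta>\<^sub>0 ^ 3 + 4 * \<delta>\<^sub>0\<^sup>2 - 5 * \<delta>\<^sub>0 + 1)))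
       \<and> (delta_minus \<le> \<delta>\<^sub>0 \<longrightarrow>
            is_arg_min (rho J \<delta>\<^sub>0) (\<lambda>_. True)
              (2 * \<delta>\<^sub>0\<^sup>2 / (2 * \<delta>\<^sub>0\<^sup>2 + \<delta>\<^sub>0 - 1)))
       \<and> (\<delta>\<^sub>0 > 1 \<longrightarrow> (\<exists>!\<alpha>. is_arg_min (rho J \<delta>\<^sub>0) (\<lambda>_. True) \<alpha>))
       \<and> 1.41964 \<le> delta_plus \<and> delta_plus < 1.41965"
proof -
  define g where "g = 2 * \<delta>\<^sub>0 - 1"
  define t where "t = 2 * delta_plus - 1"
  define m M where "m = min (2 * g / (g + 1)) (g - 1 / g)" and "M = max 2 g"
  have g: "g \<ge> 1" and \<delta>: "\<delta>\<^sub>0 = (g + 1) / 2"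
    using assms by (simp_all add: g_def)
  have t: "t ^ 3 = t\<^sup>2 + t + 1" "t > 1"
    using cubic_delta_plus by (simp_all add: t_def)
  note sign = cubic_sign[OF t]
  have rho: "rho J \<delta>\<^sub>0 \<alpha> = ereal (max \<bar>1 - \<alpha> / \<delta>\<^sub>0 * m\<bar> \<bar>1 - \<alpha> / \<delta>\<^sub>0 * M\<bar>)" for \<alpha>
    unfolding m_def M_def g_def by (rule rho_eq) (use assms in auto)
  have frac: "2 * g / (g + 1) \<le> 2" "0 < 2 * g / (g + 1)"
    using g by (simp_all add: field_simps)
  have m: "0 \<le> m" "m \<le> M" "0 < M"
  proof -
    have "1 / g \<le> 1"
      using g by simp
    then show "0 \<le> m"
      unfolding m_def using g frac by linarith
    show "m \<le> M"
      unfolding m_def M_def using frac by linarith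
  qed (simp add: M_def)
  note opt = rho_optimal[of J \<delta>\<^sub>0 m M, OF rho m]
  \<comment> \<open>Decides which of the two lower endpoint values is \<open>m\<close>. The change
    of roles happens at the root \<open>t\<close> of the cubic, that is, at
    \<open>delta_plus\<close>.\<close>
  have compare: "2 * g / (g + 1) \<le> g - 1 / g \<longleftrightarrow> g\<^sup>2 + g + 1 \<le> g ^ 3"
    "g - 1 / g \<le> 2 * g / (g + 1) \<longleftrightarrow> g ^ 3 \<le> g\<^sup>2 + g + 1"
  proof -
    have "g - 1 / g - 2 * g / (g + 1) = (g ^ 3 - (g\<^sup>2 + g + 1)) / (g * (g + 1))"
      using g by (simp add: power3_eq_cube power2_eq_square field_simps)
    moreover have "g * (g + 1) > 0"
      using g by simp
    ultimately show "2 * g / (g + 1) \<le> g - 1 / g \<longleftrightarrow> g\<^sup>2 + g + 1 \<le> g ^ 3"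
      "g - 1 / g \<le> 2 * g / (g + 1) \<longleftrightarrow> g ^ 3 \<le> g\<^sup>2 + g + 1"
      using zero_le_divide_iff[of "g ^ 3 - (g\<^sup>2 + g + 1)" "g * (g + 1)"]
        divide_le_0_iff[of "g ^ 3 - (g\<^sup>2 + g + 1)" "g * (g + 1)"] by linarith+
  qed
  have num: "1.41964 \<le> delta_plus" "delta_plus < 1.41965"
  proof -
    \<comment> \<open>The decimal bounds carried over by \<open>t = 2 * delta_plus - 1\<close>; the
      sign of the cubic there tells on which side of \<open>t\<close> they lie.\<close>
    have "1.83928 \<le> t"
      using sign(1)[of "1.83928"] by (simp add: power3_eq_cube power2_eq_square)
    then show "1.41964 \<le> delta_plus" by (simp add: t_def)
    have "\<not> 1.8393 \<le> t"
      using sign(1)[of "1.8393"] by (simp add: power3_eq_cube power2_eq_square)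
    then show "delta_plus < 1.41965" by (simp add: t_def)
  qed
  have min: "is_arg_min (rho J \<delta>\<^sub>0) (\<lambda>_. True) (2 * \<delta>\<^sub>0 / (m + M))"
    using opt(1) assms by simp
  have c1: "is_arg_min (rho J \<delta>\<^sub>0) (\<lambda>_. True) (\<delta>\<^sub>0 * (2 * \<delta>\<^sub>0 - 1) / (2 * \<delta>\<^sub>0\<^sup>2 - 1))"
    if "\<delta>\<^sub>0 \<le> delta_plus"
  proof -
    \<comment> \<open>The bound by 2 uses that \<open>delta_plus\<close> is below
      \<open>delta_minus\<close>, which the decimals show.\<close>
    have "g \<le> t" "g \<le> 2"
      using that num by (simp_all add: g_def t_def)
    then have "m = g - 1 / g" "M = 2"
      using sign(1)[OF g] compare by (auto simp: m_def M_def)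
    moreover have "g\<^sup>2 + 2 * g - 1 > 0"
      using g by (smt (verit) zero_le_power2)
    then have "2 * \<delta>\<^sub>0 / (g - 1 / g + 2) = \<delta>\<^sub>0 * (2 * \<delta>\<^sub>0 - 1) / (2 * \<delta>\<^sub>0\<^sup>2 - 1)"
      using g unfolding \<delta> by (simp add: power2_eq_square divide_simps) (simp add: algebra_simps)
    ultimately show ?thesis
      using min by simp
  qed
  have c2: "is_arg_min (rho J \<delta>\<^sub>0) (\<lambda>_. True) (2 * \<delta>\<^sub>0\<^sup>2 * (2 * \<delta>\<^sub>0 - 1) /
      (\<delta>\<^sub>0 * \<bar>2 * \<delta>\<^sub>0\<^sup>2 - 4 * \<delta>\<^sub>0 + 1\<bar> + 2 * \<delta>\<^sub>0 ^ 3 + 4 * \<delta>\<^sub>0\<^sup>2 - 5 * \<delta>\<^sub>0 + 1))"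
    if "delta_plus \<le> \<delta>\<^sub>0" "\<delta>\<^sub>0 \<le> delta_minus"
  proof -
    have "t \<le> g" "g \<le> 2"
      using that by (simp_all add: g_def t_def delta_minus_def)
    then have "m = 2 * g / (g + 1)" "M = 2"
      using sign(2)[OF g] compare by (auto simp: m_def M_def)
    moreover have "2 * \<delta>\<^sub>0 / (2 * g / (g + 1) + 2) = 2 * \<delta>\<^sub>0\<^sup>2 * (2 * \<delta>\<^sub>0 - 1) / ((4 * \<delta>\<^sub>0 - 1) * (2 * \<delta>\<^sub>0 - 1))"
      using g unfolding \<delta> by (simp add: power2_eq_square divide_simps) (simp add: algebra_simps)
    \<comment> \<open>The argument of the absolute value is
      \<open>2 * (\<delta>\<^sub>0 - 1)\<^sup>2 - 1\<close>, negative on this range. The denominator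
      then factors, and \<open>2 * \<delta>\<^sub>0 - 1\<close> cancels.\<close>
    moreover have "2 * \<delta>\<^sub>0\<^sup>2 - 4 * \<delta>\<^sub>0 + 1 \<le> 0"
    proof -
      have "(\<delta>\<^sub>0 - 1) * (\<delta>\<^sub>0 - 1) \<le> (1 / 2) * (1 / 2)"
        using that assms by (intro mult_mono) (simp_all add: delta_minus_def)
      then show ?thesis by (simp add: power2_eq_square algebra_simps)
    qed
    then have "\<delta>\<^sub>0 * \<bar>2 * \<delta>\<^sub>0\<^sup>2 - 4 * \<delta>\<^sub>0 + 1\<bar> + 2 * \<delta>\<^sub>0 ^ 3 + 4 * \<delta>\<^sub>0\<^sup>2 - 5 * \<delta>\<^sub>0 + 1 = (4 * \<delta>\<^sub>0 - 1) * (2 * \<delta>\<^sub>0 - 1)"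
      by (simp add: abs_of_nonpos power3_eq_cube power2_eq_square algebra_simps)
    ultimately show ?thesis
      using min by simp
  qed
  have c3: "is_arg_min (rho J \<delta>\<^sub>0) (\<lambda>_. True) (2 * \<delta>\<^sub>0\<^sup>2 / (2 * \<delta>\<^sub>0\<^sup>2 + \<delta>\<^sub>0 - 1))"
    if "delta_minus \<le> \<delta>\<^sub>0"
  proof -
    have "t \<le> g" "2 \<le> g"
      using that num by (simp_all add: g_def t_def delta_minus_def)
    then have "m = 2 * g / (g + 1)" "M = g"
      using sign(2)[OF g] compare by (auto simp: m_def M_def)
    moreover have "2 * \<delta>\<^sub>0 / (2 * g / (g + 1) + g) = 2 * \<delta>\<^sub>0\<^sup>2 / (2 * \<delta>\<^sub>0\<^sup>2 + \<delta>\<^sub>0 - 1)"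
    proof -
      have "2 * g + g * (g + 1) > 0" "g * g + 3 * g > 0"
        using g by (simp_all add: add_pos_pos)
      then show ?thesis
        using g unfolding \<delta> by (simp add: power2_eq_square divide_simps) (simp add: algebra_simps)
    qed
    ultimately show ?thesis
      using min by simp
  qed
  \<comment> \<open>At \<open>\<delta>\<^sub>0 = 1\<close> the smallest rate is 0 and a whole
    interval of parameters is optimal; beyond it \<open>m\<close> is positive.\<close>
  have "\<exists>!\<alpha>. is_arg_min (rho J \<delta>\<^sub>0) (\<lambda>_. True) \<alpha>" if "\<delta>\<^sub>0 > 1"
  proof -
    have "g > 1"
      using that by (simp add: g_def)
    then have "1 / g < 1"
      by simp
    with \<open>g > 1\<close> have "m > 0"
      unfolding m_def using frac by linarith
    then have "\<alpha> = 2 * \<delta>\<^sub>0 / (m + M)" if "is_arg_min (rho J \<delta>\<^sub>0) (\<lambda>_. True) \<alpha>" for \<alpha>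
      using opt(2)[OF _ _ that] assms by simp
    with min show ?thesis
      by blast
  qed
  with c1 c2 c3 num show ?thesis by blast
qed

end
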